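(* Let $\mathbb{D}$ be a division ring with finite dimension $d$ over a central subfield $\mathbb{F}$. Let $U$ and $V$ be finite-dimensional right $\mathbb{D}$-vector spaces and $S$ be a deeply intransitive $\mathbb{F}$-linear subspace of $\operatorname{Hom}_{\mathbb{D}}(U,V)$. Set $n:=\dim_{\mathbb{D}}V$ and $\alpha(n,d):=n(d-1)+d\binom{n}{2}$, and assume that $|\mathbb{F}|\geq nd$. Then (dimension of $S$ being over $\mathbb{F}$): (a) $\dim S\leq\alpha(n,d)$. (b) $\dim S\leq\alpha(n,d)-n+\max(2-d,0)$ if $\operatorname{trk}(S)<nd-1$. (c) If $\dim S\geq\alpha(n,d)-n+\max(4-d,2)$, then $S$ has a right-nondegenerate alternator $b$, and $\operatorname{Alt}(S)=\mathbb{F}b$.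
   Context: A central subfield of $\mathbb{D}$ is a subfield contained in the center of $\mathbb{D}$. $\operatorname{Hom}_{\mathbb{D}}(U,V)$ is the $\mathbb{F}$-vector space of $\mathbb{D}$-linear maps from $U$ to $V$. For an $\mathbb{F}$-linear subspace $S$ of $\operatorname{Hom}_{\mathbb{D}}(U,V)$ and $x\in U$, write $Sx:=\{f(x):f\in S\}$. $S$ is intransitive if $Sx\neq V$ for all $x\in U$. For a $\mathbb{D}$-linear subspace $V'$ of $V$, $S^{V'}$ is the set of all $f\in S$ whose range is contained in $V'$. $S$ is deeply intransitive if it is intransitive and, for every nonzero $\mathbb{D}$-linear subspace $V'$ of $V$, the space $S^{V'}$ is intransitive as an $\mathbb{F}$-linear subspace of $\operatorname{Hom}_{\mathbb{D}}(U,V')$. The transitive rank $\operatorname{trk}(S)$ is the maximum of $\dim_{\mathbb{F}}(Sx)$ over $x\in U$. An alternator of $S$ is an $\mathbb{F}$-bilinear form $b:U\times V\to\mathbb{F}$ such that $b(x,f(x))=0$ for all $x\in U$ and $f\in S$; $\operatorname{Alt}(S)$ is the $\mathbb{F}$-vector space of all alternators of $S$. The form $b$ is right-nondegenerate if $\{y\in V: b(x,y)=0\text{ for all }x\in U\}=\{0\}$. *)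

theory Defs
  imports Complex_Main "HOL-Library.Function_Algebras"
begin

text \<open>
  The library's locale \<^locale>\<open>vector_space\<close> requires a (commutative) field of scalars, so right
  vector spaces over a division ring are introduced here.  All notions of linear algebra over the
  central subfield are those of \<^locale>\<open>vector_space\<close>.
\<close>

locale right_vector_space =
  fixes rscale :: "'v::ab_group_add \<Rightarrow> 'd::division_ring \<Rightarrow> 'v"  (infixl "\<cdot>" 75)
  assumes add_rscale: "(x + y) \<cdot> a = x \<cdot> a + y \<cdot> a"
    and rscale_add: "x \<cdot> (a + b) = x \<cdot> a + x \<cdot> b"
    and rscale_rscale: "(x \<cdot> a) \<cdot> b = x \<cdot> (a * b)"
    and rscale_one: "x \<cdot> 1 = x"
begin

definition subspace :: "'v set \<Rightarrow> bool" where
  "subspace W \<longleftrightarrow> 0 \<in> W \<and> (\<forall>x\<in>W. \<forall>y\<in>W. x + y \<in> W) \<and> (\<forall>x\<in>W. \<forall>a. x \<cdot> a \<in> W)"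

definition span :: "'v set \<Rightarrow> 'v set" where
  "span B = subspace hull B"

definition independent :: "'v set \<Rightarrow> bool" where
  "independent B \<longleftrightarrow>
     (\<forall>A c. finite A \<longrightarrow> A \<subseteq> B \<longrightarrow> (\<Sum>x\<in>A. x \<cdot> c x) = 0 \<longrightarrow> (\<forall>x\<in>A. c x = 0))"

definition basis :: "'v set \<Rightarrow> bool" where
  "basis B \<longleftrightarrow> independent B \<and> span B = UNIV"

definition finite_dimensional :: bool where
  "finite_dimensional \<longleftrightarrow> (\<exists>B. finite B \<and> span B = UNIV)"

text \<open>Only meaningful for finite-dimensional spaces.\<close>

definition dimension :: nat where
  "dimension = card (SOME B. basis B)"

end

definition Hom :: "('u::ab_group_add \<Rightarrow> 'd::division_ring \<Rightarrow> 'u) \<Rightarrow>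
    ('v::ab_group_add \<Rightarrow> 'd \<Rightarrow> 'v) \<Rightarrow> ('u \<Rightarrow> 'v) set" where
  "Hom sU sV = {f. (\<forall>x y. f (x + y) = f x + f y) \<and> (\<forall>x a. f (sU x a) = sV (f x) a)}"

text \<open>
  A central subfield is given as a field \<open>'f\<close> together with a unital ring homomorphism \<open>\<iota>\<close> into the
  centre of the division ring.  Such a map is injective (see below), so \<open>\<iota>\<close> identifies \<open>'f\<close> with the
  central subfield \<open>range \<iota>\<close>, and every central subfield arises in this way.
\<close>

definition central_subfield :: "('f::field \<Rightarrow> 'd::division_ring) \<Rightarrow> bool" where
  "central_subfield \<iota> \<longleftrightarrow>
     \<iota> 1 = 1 \<and> (\<forall>a b. \<iota> (a + b) = \<iota> a + \<iota> b) \<and> (\<forall>a b. \<iota> (a * b) = \<iota> a * \<iota> b) \<and>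
     (\<forall>a z. \<iota> a * z = z * \<iota> a)"

text \<open>
  Restriction of scalars to the central subfield.  With \<open>s = (*)\<close> this is the structure of a
  vector space over \<open>'f\<close> on the division ring itself.
\<close>

definition restrict_scalars ::
    "('f \<Rightarrow> 'd) \<Rightarrow> ('v \<Rightarrow> 'd \<Rightarrow> 'v) \<Rightarrow> 'f \<Rightarrow> 'v \<Rightarrow> 'v" where
  "restrict_scalars \<iota> s c x = s x (\<iota> c)"

definition pointwise_scale :: "('f \<Rightarrow> 'v \<Rightarrow> 'v) \<Rightarrow> 'f \<Rightarrow> ('u \<Rightarrow> 'v) \<Rightarrow> ('u \<Rightarrow> 'v)" where
  "pointwise_scale s c f = (\<lambda>x. s c (f x))"

text \<open>The value \<open>S x\<close>, for a set \<open>S\<close> of maps.\<close>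

definition eval_at :: "('u \<Rightarrow> 'v) set \<Rightarrow> 'u \<Rightarrow> 'v set" where
  "eval_at S x = {f x | f. f \<in> S}"

text \<open>Intransitivity of \<open>S\<close> as a set of maps with codomain \<open>W\<close>.\<close>

definition intransitive :: "('u \<Rightarrow> 'v) set \<Rightarrow> 'v set \<Rightarrow> bool" where
  "intransitive S W \<longleftrightarrow> (\<forall>x. eval_at S x \<noteq> W)"

text \<open>The set of maps written \<open>S\<close> with exponent \<open>W\<close> on paper.\<close>

definition maps_into :: "('u \<Rightarrow> 'v) set \<Rightarrow> 'v set \<Rightarrow> ('u \<Rightarrow> 'v) set" where
  "maps_into S W = {f \<in> S. range f \<subseteq> W}"

definition deeply_intransitive ::
    "('v::ab_group_add \<Rightarrow> 'd::division_ring \<Rightarrow> 'v) \<Rightarrow> ('u \<Rightarrow> 'v) set \<Rightarrow> bool" where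
  "deeply_intransitive sV S \<longleftrightarrow>
     intransitive S UNIV \<and>
     (\<forall>W. right_vector_space.subspace sV W \<longrightarrow> W \<noteq> {0} \<longrightarrow> intransitive (maps_into S W) W)"

definition trk :: "('f::field \<Rightarrow> 'v::ab_group_add \<Rightarrow> 'v) \<Rightarrow> ('u \<Rightarrow> 'v) set \<Rightarrow> nat" where
  "trk s S = Max (range (\<lambda>x. vector_space.dim s (eval_at S x)))"

definition Alt :: "('f::field \<Rightarrow> 'u::ab_group_add \<Rightarrow> 'u) \<Rightarrow> ('f \<Rightarrow> 'v::ab_group_add \<Rightarrow> 'v) \<Rightarrow>
    ('u \<Rightarrow> 'v) set \<Rightarrow> ('u \<Rightarrow> 'v \<Rightarrow> 'f) set" where
  "Alt sU sV S =
     {b. (\<forall>y. Vector_Spaces.linear sU (*) (\<lambda>x. b x y)) \<and>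
         (\<forall>x. Vector_Spaces.linear sV (*) (b x)) \<and>
         (\<forall>x. \<forall>f\<in>S. b x (f x) = 0)}"

definition right_nondegenerate :: "('u \<Rightarrow> 'v::ab_group_add \<Rightarrow> 'f::field) \<Rightarrow> bool" where
  "right_nondegenerate b \<longleftrightarrow> {y. \<forall>x. b x y = 0} = {0}"

definition \<alpha> :: "nat \<Rightarrow> nat \<Rightarrow> int" where
  "\<alpha> n d = int n * (int d - 1) + int d * int (n choose 2)"

lemma central_subfield_inj:
  assumes "central_subfield \<iota>"
  shows "inj \<iota>"
proof (rule injI)
  fix a b assume eq: "\<iota> a = \<iota> b"
  have add: "\<iota> (x + y) = \<iota> x + \<iota> y" for x y
    using assms by (simp add: central_subfield_def)
  have "\<iota> (a - b) + \<iota> b = \<iota> a"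
    by (simp flip: add)
  hence z: "\<iota> (a - b) = 0"
    using eq by simp
  show "a = b"
  proof (rule ccontr)
    assume "a \<noteq> b"
    hence "\<iota> (a - b) * \<iota> (inverse (a - b)) = 1"
      using assms unfolding central_subfield_def by (metis right_inverse right_minus_eq)
    thus False
      using z by simp
  qed
qed

lemma right_vector_space_mult: "right_vector_space ((*) :: 'd::division_ring \<Rightarrow> 'd \<Rightarrow> 'd)"
  by unfold_locales (simp_all add: algebra_simps)

lemma vector_space_restrict_scalars:
  assumes "central_subfield \<iota>" "right_vector_space s"
  shows "vector_space (restrict_scalars \<iota> s)"
proof -
  interpret right_vector_space s by fact
  have hom: "\<iota> 1 = 1" "\<iota> (a + b) = \<iota> a + \<iota> b" "\<iota> (a * b) = \<iota> b * \<iota> a" for a b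
    using assms(1) unfolding central_subfield_def by (simp, simp, metis)
  show ?thesis
    unfolding restrict_scalars_def
    by unfold_locales (simp_all only: hom add_rscale rscale_add rscale_rscale rscale_one)
qed

lemma vector_space_pointwise_scale:
  assumes "vector_space s"
  shows "vector_space (pointwise_scale s)"
  using assms unfolding vector_space_def pointwise_scale_def
  by (simp add: fun_eq_iff)

lemma subspace_Hom:
  assumes "central_subfield \<iota>" "right_vector_space sU" "right_vector_space sV"
  shows "module.subspace (pointwise_scale (restrict_scalars \<iota> sV)) (Hom sU sV)"
proof -
  interpret U: right_vector_space sU by fact
  interpret V: right_vector_space sV by fact
  interpret H: vector_space "pointwise_scale (restrict_scalars \<iota> sV)"
    by (intro vector_space_pointwise_scale vector_space_restrict_scalars assms)
  have [simp]: "sV 0 a = 0" for a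
    using V.add_rscale[of 0 0 a] by simp
  have central: "a * \<iota> c = \<iota> c * a" for a c
    using assms(1) unfolding central_subfield_def by metis
  have "sV (sV x a) (\<iota> c) = sV (sV x (\<iota> c)) a" for x a c
    by (simp only: V.rscale_rscale central)
  thus ?thesis
    unfolding H.subspace_def
    by (simp add: Hom_def pointwise_scale_def restrict_scalars_def V.add_rscale add_ac)
qed

end

theory Submission
  imports Defs
begin

text \<open>
  Write \<open>S\<^sub>x\<close> for the set of \<open>f \<in> S\<close> with \<open>f x = 0\<close>.  If \<open>dim (S x)\<close> is maximal, then a
  perturbation \<open>s x + z\<close> of \<open>x\<close> shows that all \<open>f \<in> S\<^sub>x\<close> have their range in \<open>S x\<close>, hence in the
  largest \<open>'d\<close>-linear subspace \<open>W\<close> of \<open>S x\<close>.  As \<open>S\<close> is deeply intransitive, \<open>W\<close> is proper, and (a)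
  follows by induction from \<open>dim S = dim (S x) + dim S\<^sub>x\<close>; (b) follows by the same induction, since
  equality of the subspaces \<open>W\<close> for two vectors makes \<open>S\<close> small while distinct hyperplanes force
  the rank \<open>n d - 1\<close>.

  For (c), choose \<open>x\<close> and \<open>y\<close> of rank \<open>n d - 1\<close> such that \<open>S x \<inter> S y = S\<^sub>x y + S\<^sub>y x\<close>, and forms \<open>\<phi>\<close>
  and \<open>\<psi>\<close> with kernels \<open>S x\<close> and \<open>S y\<close>.  An alternator \<open>b\<close> with \<open>b x = \<phi>\<close> and \<open>b y = \<psi>\<close> must satisfy
  \<open>b z (f x) = - \<phi> (f z)\<close> and \<open>b z (f y) = - \<psi> (f z)\<close>, which determines it.  These equations do define
  a bilinear form, and higher order perturbations yield \<open>b z (h z) = \<kappa> z \<psi> (h x)\<close>.  To see that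
  \<open>\<kappa> = 0\<close>, compare \<open>b\<close> with the forms built from \<open>(x a, y)\<close> and \<open>(x, y a)\<close> for a scalar \<open>a\<close> outside
  the central subfield; when there is none, use the form vanishing on \<open>S z\<close>.  Finally the radical
  of \<open>b\<close> is a \<open>'d\<close>-linear subspace \<open>K\<close>, and (a) applied to the maps into \<open>K\<close> and modulo \<open>K\<close> shows
  \<open>K = 0\<close>.
\<close>

section \<open>Linear algebra over a field\<close>

context vector_space
begin

lemma linear_formI:
  assumes "\<And>x y. \<phi> (x + y) = \<phi> x + \<phi> y" "\<And>c x. \<phi> (c *s x) = c * \<phi> x"
  shows "Vector_Spaces.linear scale (*) \<phi>"
proof -
  interpret F: vector_space "(*) :: 'a \<Rightarrow> 'a \<Rightarrow> 'a"
    by unfold_locales (simp_all add: algebra_simps)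
  show ?thesis
    unfolding Vector_Spaces.linear_iff using assms vector_space_axioms F.vector_space_axioms by blast
qed

lemma
  assumes "Vector_Spaces.linear scale (*) \<phi>"
  shows form_add: "\<phi> (x + y) = \<phi> x + \<phi> y" and form_scale: "\<phi> (c *s x) = c * \<phi> x"
    and form_diff: "\<phi> (x - y) = \<phi> x - \<phi> y" and form_minus: "\<phi> (- x) = - \<phi> x"
    and form_0: "\<phi> 0 = 0"
proof -
  interpret Vector_Spaces.linear scale "(*)" \<phi> by fact
  show "\<phi> (x + y) = \<phi> x + \<phi> y" "\<phi> (c *s x) = c * \<phi> x" "\<phi> (x - y) = \<phi> x - \<phi> y"
    "\<phi> (- x) = - \<phi> x" "\<phi> 0 = 0"
    by (fact add scale diff neg zero)+
qed

lemma exists_linear_form: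
  assumes "subspace A" "u \<notin> A"
  obtains \<phi> where "Vector_Spaces.linear scale (*) \<phi>" "\<phi> u = 1" "\<And>a. a \<in> A \<Longrightarrow> \<phi> a = 0"
proof -
  interpret F: vector_space "(*) :: 'a \<Rightarrow> 'a \<Rightarrow> 'a"
    by unfold_locales (simp_all add: algebra_simps)
  interpret vector_space_pair scale "(*) :: 'a \<Rightarrow> 'a \<Rightarrow> 'a" ..
  obtain B where B: "B \<subseteq> A" "independent B" "A \<subseteq> span B"
    using maximal_independent_subset by blast
  have A: "span B = A"
    using B assms(1) by (simp add: span_subspace)
  hence "independent (insert u B)"
    using assms(2) B by (intro independent_insertI) auto
  then obtain \<phi> where \<phi>: "Vector_Spaces.linear scale (*) \<phi>" "\<forall>x\<in>insert u B. \<phi> x = (if x = u then 1 else 0)"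
    using linear_independent_extend[of "insert u B" "\<lambda>x. if x = u then 1 else 0"] by blast
  interpret \<phi>: Vector_Spaces.linear scale "(*)" \<phi> by fact
  have "\<phi> a = 0" if "a \<in> A" for a
  proof (rule \<phi>.eq_0_on_span[where b = B])
    show "\<phi> x = 0" if "x \<in> B" for x
      using that \<phi>(2) B(1) assms(2) by auto
  qed (use that A in auto)
  with \<phi> show ?thesis
    by (intro that[of \<phi>]) auto
qed

lemma linear_form_multiple:
  assumes "Vector_Spaces.linear scale (*) \<theta>" "Vector_Spaces.linear scale (*) \<phi>"
    and "\<And>v. \<phi> v = 0 \<Longrightarrow> \<theta> v = 0"
  obtains a where "\<And>v. \<theta> v = a * \<phi> v"
proof (cases "\<exists>e. \<phi> e \<noteq> 0")
  case True
  then obtain e where e: "\<phi> e \<noteq> 0" by blast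
  have "\<theta> v = (\<theta> e / \<phi> e) * \<phi> v" for v
  proof -
    have "\<theta> (v - (\<phi> v / \<phi> e) *s e) = 0"
      using e by (intro assms(3)) (simp add: form_diff[OF assms(2)] form_scale[OF assms(2)])
    hence "\<theta> v = (\<phi> v / \<phi> e) * \<theta> e"
      by (simp add: form_diff[OF assms(1)] form_scale[OF assms(1)])
    thus ?thesis by simp
  qed
  thus ?thesis by (rule that)
next
  case False
  thus ?thesis using that[of 0] assms(3) by simp
qed

text \<open>Reduction to a single form: subtracting from \<theta> the multiple of \<psi> that agrees
  with it at a vector \<open>e\<close> of the kernel of \<phi> leaves a form vanishing on that whole
  kernel.\<close>

lemma linear_form_combination:
  assumes "Vector_Spaces.linear scale (*) \<theta>" "Vector_Spaces.linear scale (*) \<phi>"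
    "Vector_Spaces.linear scale (*) \<psi>"
    and "\<And>v. \<phi> v = 0 \<Longrightarrow> \<psi> v = 0 \<Longrightarrow> \<theta> v = 0"
  obtains a b where "\<And>v. \<theta> v = a * \<phi> v + b * \<psi> v"
proof (cases "\<exists>e. \<phi> e = 0 \<and> \<psi> e \<noteq> 0")
  case True
  then obtain e where e: "\<phi> e = 0" "\<psi> e \<noteq> 0" by blast
  define c where "c = \<theta> e / \<psi> e"
  have "Vector_Spaces.linear scale (*) (\<lambda>v. \<theta> v - c * \<psi> v)"
    by (rule linear_formI)
      (simp_all only: form_add[OF assms(1)] form_add[OF assms(3)] form_scale[OF assms(1)]
        form_scale[OF assms(3)] algebra_simps)
  moreover have "\<theta> v - c * \<psi> v = 0" if "\<phi> v = 0" for v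
  proof -
    have "\<theta> (v - (\<psi> v / \<psi> e) *s e) = 0"
      using e that by (intro assms(4)) (simp_all add: form_diff[OF assms(2)] form_scale[OF assms(2)]
        form_diff[OF assms(3)] form_scale[OF assms(3)])
    thus ?thesis using e by (simp add: form_diff[OF assms(1)] form_scale[OF assms(1)] c_def)
  qed
  ultimately obtain a where "\<And>v. \<theta> v - c * \<psi> v = a * \<phi> v"
    using linear_form_multiple[OF _ assms(2)] by blast
  hence "\<theta> v = a * \<phi> v + c * \<psi> v" for v
    by (metis diff_add_cancel)
  thus ?thesis by (rule that)
next
  case False
  then obtain a where "\<And>v. \<theta> v = a * \<phi> v"
    using linear_form_multiple[OF assms(1,2)] assms(4) by blast
  thus ?thesis by (intro that[of a 0]) auto
qed

text \<open>The vectors are indexed by their eigenvalues. Applying \<open>f\<close> minus the scalar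
  \<open>t\<close> to a linear relation removes the term at \<open>t\<close> and multiplies the
  others by nonzero factors, so the relation shortens.\<close>

lemma eigenvectors_independent:
  assumes "Vector_Spaces.linear scale scale f" "finite A"
    and "\<And>s. s \<in> A \<Longrightarrow> f (w s) = s *s w s" "\<And>s. s \<in> A \<Longrightarrow> w s \<noteq> 0"
  shows "inj_on w A" "independent (w ` A)"
proof -
  interpret f: Vector_Spaces.linear scale scale f by fact
  have *: "\<forall>s\<in>B. c s = 0" if "B \<subseteq> A" "(\<Sum>s\<in>B. c s *s w s) = 0" for B c
  proof -
    have "finite B" using that(1) assms(2) by (rule finite_subset)
    thus ?thesis using that
    proof (induction B arbitrary: c)
      case (insert t B)
      have "0 = f (\<Sum>s\<in>insert t B. c s *s w s) - t *s (\<Sum>s\<in>insert t B. c s *s w s)"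
        using insert.prems by simp
      also have "\<dots> = (\<Sum>s\<in>insert t B. c s *s f (w s)) - (\<Sum>s\<in>insert t B. t *s c s *s w s)"
        by (simp only: f.sum f.scale scale_sum_right)
      also have "\<dots> = (\<Sum>s\<in>insert t B. (c s * (s - t)) *s w s)"
        unfolding sum_subtractf[symmetric] using insert.prems assms(3)
        by (intro sum.cong) (auto simp: algebra_simps subsetD)
      finally have "(\<Sum>s\<in>B. (c s * (s - t)) *s w s) = 0"
        using insert.hyps by simp
      hence "\<forall>s\<in>B. c s * (s - t) = 0"
        using insert.IH[of "\<lambda>s. c s * (s - t)"] insert.prems(1) by simp
      hence "\<forall>s\<in>B. c s = 0"
        using insert.hyps by auto
      moreover from this have "c t *s w t = 0"
        using insert.hyps insert.prems(2) by simp
      ultimately show ?case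
        using assms(4)[of t] insert.prems by simp
    qed auto
  qed
  show inj: "inj_on w A"
  proof (rule inj_onI)
    fix s t assume st: "s \<in> A" "t \<in> A" "w s = w t"
    show "s = t"
    proof (rule ccontr)
      assume "s \<noteq> t"
      thus False
        using *[of "{s, t}" "\<lambda>r. if r = s then 1 else -1"] st by simp
    qed
  qed
  show "independent (w ` A)"
  proof (rule independent_if_scalars_zero)
    fix c x assume "(\<Sum>x\<in>w ` A. c x *s x) = 0" "x \<in> w ` A"
    thus "c x = 0"
      using *[of A "c \<circ> w"] by (auto simp: sum.reindex[OF inj])
  qed (use assms in auto)
qed

end

context finite_dimensional_vector_space
begin

text \<open>Otherwise, modulo \<open>u\<close>, every scalar would be an eigenvalue of \<open>- c\<close> compressed to \<open>E\<close>.\<close>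

lemma exists_injective_perturbation:
  assumes "Vector_Spaces.linear scale scale c" "subspace E" "u \<notin> E \<or> u = 0"
    and "infinite (UNIV :: 'a set) \<or> dim E < card (UNIV :: 'a set)"
  obtains s where "\<And>v k. v \<in> E \<Longrightarrow> s *s v + c v = k *s u \<Longrightarrow> v = 0"
proof -
  interpret P: vector_space_pair scale scale ..
  interpret c: Vector_Spaces.linear scale scale c by fact
  \<comment> \<open>\<open>p\<close> is a projection onto \<open>E\<close> that also kills
    \<open>u\<close>. Any projection onto \<open>E\<close> is corrected by a form that vanishes on
    \<open>E\<close> and is 1 at \<open>u\<close>.\<close>
  obtain p where p: "Vector_Spaces.linear scale scale p" "\<And>v. v \<in> E \<Longrightarrow> p v = v" "p u = 0"
  proof -
    have "Vector_Spaces.linear scale scale id" by (rule linear_id)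
    then obtain p where p: "range p \<subseteq> E" "Vector_Spaces.linear scale scale p" "\<forall>v\<in>E. p (id v) = v"
      using P.linear_exists_left_inverse_on[OF _ assms(2), of id] by auto
    interpret p: Vector_Spaces.linear scale scale p by fact
    show ?thesis
    proof (cases "u = 0")
      case True
      thus ?thesis using that[of p] p by simp
    next
      case False
      with assms(3) obtain \<phi> where \<phi>: "Vector_Spaces.linear scale (*) \<phi>" "\<phi> u = 1"
        "\<And>a. a \<in> E \<Longrightarrow> \<phi> a = 0"
        using exists_linear_form[OF assms(2)] by blast
      interpret \<phi>: Vector_Spaces.linear scale "(*)" \<phi> by fact
      have "Vector_Spaces.linear scale scale (\<lambda>v. p v - \<phi> v *s p u)"
        by unfold_locales (simp_all add: p.add p.scale \<phi>.add \<phi>.scale algebra_simps)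
      thus ?thesis
        using that[of "\<lambda>v. p v - \<phi> v *s p u"] p \<phi> by auto
    qed
  qed
  interpret p: Vector_Spaces.linear scale scale p by fact
  have "\<exists>s. \<forall>v k. v \<in> E \<longrightarrow> s *s v + c v = k *s u \<longrightarrow> v = 0"
  proof (rule ccontr)
    assume "\<not> ?thesis"
    hence "\<forall>s. \<exists>v. v \<in> E \<and> (\<exists>k. s *s v + c v = k *s u) \<and> v \<noteq> 0" by blast
    then obtain w where w: "\<And>s. w s \<in> E" "\<And>s. \<exists>k. s *s w s + c (w s) = k *s u" "\<And>s. w s \<noteq> 0"
      by metis
    have lin: "Vector_Spaces.linear scale scale (\<lambda>v. - p (c v))"
      by unfold_locales (simp_all add: p.add p.scale c.add c.scale algebra_simps)
    have eig: "- p (c (w s)) = s *s w s" for s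
    proof -
      obtain k where "s *s w s + c (w s) = k *s u" using w(2) by blast
      hence "p (s *s w s + c (w s)) = 0" using p(3) by (simp add: p.scale)
      hence "s *s w s + p (c (w s)) = 0" by (simp add: p.add p.scale p(2) w(1))
      thus ?thesis by (simp add: neg_eq_iff_add_eq_0 add.commute)
    qed
    \<comment> \<open>More than \<open>dim E\<close> scalars would each have an eigenvector in
      \<open>E\<close>, and these are independent.\<close>
    obtain A :: "'a set" where A: "finite A" "dim E < card A"
      using assms(4)
      by (metis infinite_arbitrarily_large lessI card.infinite not_less_zero)
    have "card (w ` A) \<le> dim E"
      using eigenvectors_independent(2)[OF lin A(1) eig w(3)] w(1)
      by (intro independent_card_le_dim) auto
    thus False
      using A card_image[OF eigenvectors_independent(1)[OF lin A(1) eig w(3)]] by simp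
  qed
  thus ?thesis using that by blast
qed

end

text \<open>Finiteness is asked only of the kernel and the image, so that the lemma applies to
  evaluation on spaces of maps, whose ambient function space can be infinite-dimensional. Finite
  generation of \<open>S\<close> is part of the conclusion because \<open>dim\<close> is 0 on
  infinite-dimensional spaces.\<close>

lemma (in vector_space_pair) rank_nullity_on:
  assumes lin: "Vector_Spaces.linear s1 s2 f" and S: "vs1.subspace S"
    and K: "finite B" "{x \<in> S. f x = 0} \<subseteq> vs1.span B"
    and R: "finite C" "f ` S \<subseteq> vs2.span C"
  shows "\<exists>B'. finite B' \<and> S \<subseteq> vs1.span B'"
    "vs1.dim S = vs2.dim (f ` S) + vs1.dim {x \<in> S. f x = 0}"
proof -
  interpret f: Vector_Spaces.linear s1 s2 f by fact
  let ?K = "{x \<in> S. f x = 0}"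
  obtain g where g: "range g \<subseteq> S" "Vector_Spaces.linear s2 s1 g" "\<forall>v\<in>f ` S. f (g v) = v"
    using linear_exists_right_inverse_on[OF lin S] by auto
  interpret g: Vector_Spaces.linear s2 s1 g by fact
  obtain K0 where K0: "K0 \<subseteq> ?K" "vs1.independent K0" "?K \<subseteq> vs1.span K0" "card K0 = vs1.dim ?K"
    using vs1.basis_exists by blast
  obtain R0 where R0: "R0 \<subseteq> f ` S" "vs2.independent R0" "f ` S \<subseteq> vs2.span R0"
    "card R0 = vs2.dim (f ` S)"
    using vs2.basis_exists by blast
  have finK0: "finite K0"
    using vs1.independent_span_bound[OF K(1) K0(2)] K0(1) K(2) by auto
  have finR0: "finite R0"
    using vs2.independent_span_bound[OF R(1) R0(2)] R0(1) R(2) by auto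
  have fg: "f (g v) = v" if "v \<in> R0" for v
    using g(3) that R0(1) by blast
  have inj: "inj_on g R0"
    using fg by (rule inj_on_inverseI)
  have disj: "K0 \<inter> g ` R0 = {}"
  proof -
    have "0 \<notin> R0" using R0(2) vs2.dependent_zero by blast
    thus ?thesis using K0(1) fg by force
  qed
  have span: "S \<subseteq> vs1.span (K0 \<union> g ` R0)"
  proof
    fix x assume x: "x \<in> S"
    have "g (f x) \<in> g ` vs2.span R0"
      using x R0(3) by blast
    hence 1: "g (f x) \<in> vs1.span (K0 \<union> g ` R0)"
      unfolding g.span_image[symmetric] using vs1.span_mono[of "g ` R0"] by blast
    have "x - g (f x) \<in> ?K"
      using x g S by (auto simp: f.diff intro!: vs1.subspace_diff)
    hence "x - g (f x) \<in> vs1.span (K0 \<union> g ` R0)"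
      using K0(3) vs1.span_mono[of K0] by blast
    from vs1.span_add[OF this 1] show "x \<in> vs1.span (K0 \<union> g ` R0)" by simp
  qed
  have indep: "vs1.independent (K0 \<union> g ` R0)"
  proof (rule vs1.independent_if_scalars_zero)
    fix c x assume sum: "(\<Sum>x\<in>K0 \<union> g ` R0. s1 (c x) x) = 0" and x: "x \<in> K0 \<union> g ` R0"
    have eq: "(\<Sum>x\<in>K0. s1 (c x) x) + (\<Sum>v\<in>R0. s1 (c (g v)) (g v)) = 0"
      using sum finK0 finR0 disj inj by (simp add: sum.union_disjoint sum.reindex)
    hence "f ((\<Sum>x\<in>K0. s1 (c x) x) + (\<Sum>v\<in>R0. s1 (c (g v)) (g v))) = 0"
      by simp
    moreover have "(\<Sum>x\<in>K0. s2 (c x) (f x)) = 0"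
      using K0(1) by (intro sum.neutral) auto
    ultimately have "(\<Sum>v\<in>R0. s2 (c (g v)) v) = 0"
      using fg by (simp add: f.add f.sum f.scale)
    hence R: "c (g v) = 0" if "v \<in> R0" for v
      using vs2.independentD[OF R0(2) finR0, where u = "\<lambda>v. c (g v)"] that by blast
    hence "(\<Sum>x\<in>K0. s1 (c x) x) = 0"
      using eq by simp
    hence "c x = 0" if "x \<in> K0" for x
      using vs1.independentD[OF K0(2) finK0, where u = c] that by blast
    thus "c x = 0" using x R by auto
  qed (use finK0 finR0 in auto)
  show "\<exists>B'. finite B' \<and> S \<subseteq> vs1.span B'"
    using span finK0 finR0 by (intro exI[of _ "K0 \<union> g ` R0"] conjI) simp_all
  have "vs1.dim S = card (K0 \<union> g ` R0)"
    using span indep K0(1) g(1) by (intro vs1.basis_card_eq_dim[symmetric]) blast+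
  thus "vs1.dim S = vs2.dim (f ` S) + vs1.dim ?K"
    using finK0 finR0 disj inj K0(4) R0(4) by (simp add: card_Un_disjoint card_image)
qed

section \<open>Subspaces over the division ring\<close>

locale division_ring_spaces =
  U: right_vector_space sU + V: right_vector_space sV +
  D: finite_dimensional_vector_space "restrict_scalars \<iota> ((*) :: 'd \<Rightarrow> 'd \<Rightarrow> 'd)" BD +
  VF: finite_dimensional_vector_space "restrict_scalars \<iota> sV" BV
  for \<iota> :: "'f::field \<Rightarrow> 'd::division_ring"
    and sU :: "'u::ab_group_add \<Rightarrow> 'd \<Rightarrow> 'u"
    and sV :: "'v::ab_group_add \<Rightarrow> 'd \<Rightarrow> 'v"
    and BD BV +
  assumes central: "central_subfield \<iota>"
begin

sublocale UF: vector_space "restrict_scalars \<iota> sU"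
  by (intro vector_space_restrict_scalars central U.right_vector_space_axioms)

sublocale H: vector_space "pointwise_scale (restrict_scalars \<iota> sV) :: 'f \<Rightarrow> ('u \<Rightarrow> 'v) \<Rightarrow> 'u \<Rightarrow> 'v"
  by (intro vector_space_pointwise_scale VF.vector_space_axioms)

sublocale ev: vector_space_pair "pointwise_scale (restrict_scalars \<iota> sV) :: 'f \<Rightarrow> ('u \<Rightarrow> 'v) \<Rightarrow> 'u \<Rightarrow> 'v"
  "restrict_scalars \<iota> sV" ..

abbreviation d where "d \<equiv> D.dim UNIV"

declare D.dim_UNIV [simp del] VF.dim_UNIV [simp del]

notation sV (infixl "\<cdot>" 75)

lemma \<iota>_simps [simp]: "\<iota> 1 = 1" "\<iota> 0 = 0"
  and \<iota>_add: "\<iota> (a + b) = \<iota> a + \<iota> b" and \<iota>_mult: "\<iota> (a * b) = \<iota> a * \<iota> b"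
  and \<iota>_central: "\<iota> a * z = z * \<iota> a"
proof -
  show "\<iota> 1 = 1" "\<iota> (a + b) = \<iota> a + \<iota> b" "\<iota> (a * b) = \<iota> a * \<iota> b" "\<iota> a * z = z * \<iota> a"
    using central unfolding central_subfield_def by blast+
  have "\<iota> 0 + \<iota> 0 = \<iota> 0"
    using central unfolding central_subfield_def by (metis add.left_neutral)
  thus "\<iota> 0 = 0" by simp
qed

lemma \<iota>_minus: "\<iota> (- a) = - \<iota> a"
proof -
  have "\<iota> (- a) + \<iota> a = 0" by (simp flip: \<iota>_add)
  thus ?thesis by (simp add: eq_neg_iff_add_eq_0)
qed

lemma \<iota>_eq_0 [simp]: "\<iota> a = 0 \<longleftrightarrow> a = 0"
  using injD[OF central_subfield_inj[OF central], of a 0] by auto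

lemma V_zero_rscale [simp]: "0 \<cdot> a = 0"
  using V.add_rscale[of 0 0 a] by simp

lemma V_rscale_zero [simp]: "x \<cdot> 0 = 0"
  using V.rscale_add[of x 0 0] by simp

lemma V_minus_rscale: "(- x) \<cdot> a = - (x \<cdot> a)"
  using V.add_rscale[of x "- x" a] by (simp add: eq_neg_iff_add_eq_0 add.commute)

lemma V_diff_rscale: "(x - y) \<cdot> a = x \<cdot> a - y \<cdot> a"
  using V.add_rscale[of x "- y" a] by (simp add: V_minus_rscale)

lemma V_rscale_minus: "x \<cdot> (- a) = - (x \<cdot> a)"
  using V.rscale_add[of x a "- a"] by (simp add: eq_neg_iff_add_eq_0 add.commute)

lemma V_rscale_inverse [simp]:
  "a \<noteq> 0 \<Longrightarrow> x \<cdot> a \<cdot> inverse a = x" "a \<noteq> 0 \<Longrightarrow> x \<cdot> inverse a \<cdot> a = x"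
  by (simp_all add: V.rscale_rscale V.rscale_one)

lemma U_rscale_inverse [simp]:
  "a \<noteq> 0 \<Longrightarrow> sU (sU x a) (inverse a) = x" "a \<noteq> 0 \<Longrightarrow> sU (sU x (inverse a)) a = x"
  by (simp_all add: U.rscale_rscale U.rscale_one)

lemma VF_scale_eq: "restrict_scalars \<iota> sV c v = v \<cdot> \<iota> c"
  by (simp add: restrict_scalars_def)

lemma d_pos: "d > 0"
proof (rule ccontr)
  assume "\<not> d > 0"
  hence "UNIV \<subseteq> {0::'d}" using D.dim_eq_0 by blast
  thus False by (metis UNIV_I singletonD subsetD zero_neq_one)
qed

lemma V_subspaceD:
  assumes "V.subspace W"
  shows "0 \<in> W" "x \<in> W \<Longrightarrow> y \<in> W \<Longrightarrow> x + y \<in> W" "x \<in> W \<Longrightarrow> x \<cdot> a \<in> W"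
    "x \<in> W \<Longrightarrow> - x \<in> W" "x \<in> W \<Longrightarrow> y \<in> W \<Longrightarrow> x - y \<in> W"
    "a \<noteq> 0 \<Longrightarrow> x \<cdot> a \<in> W \<longleftrightarrow> x \<in> W"
proof -
  show 1: "0 \<in> W" "x \<in> W \<Longrightarrow> y \<in> W \<Longrightarrow> x + y \<in> W" "x \<in> W \<Longrightarrow> x \<cdot> a \<in> W" for x y a
    using assms unfolding V.subspace_def by blast+
  show 2: "- x \<in> W" if "x \<in> W" for x
    using 1(3)[OF that, of "- 1"] by (simp add: V_rscale_minus V.rscale_one)
  show "x - y \<in> W" if "x \<in> W" "y \<in> W"
    using 1(2)[OF that(1) 2[OF that(2)]] by simp
  show "x \<cdot> a \<in> W \<longleftrightarrow> x \<in> W" if "a \<noteq> 0"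
    using 1(3)[of x a] 1(3)[of "x \<cdot> a" "inverse a"] that by auto
qed

lemma VF_subspace: "V.subspace W \<Longrightarrow> VF.subspace W"
  by (rule VF.subspaceI) (simp_all add: V_subspaceD VF_scale_eq)

lemma V_subspace_UNIV: "V.subspace UNIV"
  and V_subspace_0: "V.subspace {0}"
  by (auto simp: V.subspace_def)

lemma V_subspace_sums:
  assumes "V.subspace W" "V.subspace W'"
  shows "V.subspace {x + y |x y. x \<in> W \<and> y \<in> W'}"
  unfolding V.subspace_def
proof (intro conjI ballI allI)
  show "0 \<in> {x + y |x y. x \<in> W \<and> y \<in> W'}"
    using V_subspaceD(1)[OF assms(1)] V_subspaceD(1)[OF assms(2)] by (auto intro!: exI[of _ 0])
  fix u assume u: "u \<in> {x + y |x y. x \<in> W \<and> y \<in> W'}"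
  then obtain x y where xy: "u = x + y" "x \<in> W" "y \<in> W'" by blast
  show "u \<cdot> a \<in> {x + y |x y. x \<in> W \<and> y \<in> W'}" for a
    using V_subspaceD(3)[OF assms(1) xy(2)] V_subspaceD(3)[OF assms(2) xy(3)] xy(1)
    by (auto simp: V.add_rscale)
  fix v assume "v \<in> {x + y |x y. x \<in> W \<and> y \<in> W'}"
  then obtain x' y' where xy': "v = x' + y'" "x' \<in> W" "y' \<in> W'" by blast
  have "u + v = (x + x') + (y + y')" using xy xy' by simp
  thus "u + v \<in> {x + y |x y. x \<in> W \<and> y \<in> W'}"
    using xy xy' assms V_subspaceD(2) by blast
qed

lemma V_subspace_line: "V.subspace (range (\<lambda>a. w \<cdot> a))"
  unfolding V.subspace_def
  by (auto simp: V.rscale_rscale simp flip: V.rscale_add intro: range_eqI[of _ _ 0])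

lemma dim_line:
  assumes "w \<noteq> 0"
  shows "VF.dim (range (\<lambda>a. w \<cdot> a)) = d"
proof -
  interpret P: finite_dimensional_vector_space_pair_1 "restrict_scalars \<iota> ((*) :: 'd \<Rightarrow> 'd \<Rightarrow> 'd)" BD
    "restrict_scalars \<iota> sV" ..
  have "Vector_Spaces.linear (restrict_scalars \<iota> (*)) (restrict_scalars \<iota> sV) (\<lambda>a. w \<cdot> a)"
    unfolding Vector_Spaces.linear_iff using D.vector_space_axioms VF.vector_space_axioms
    by (simp add: restrict_scalars_def V.rscale_add V.rscale_rscale)
  moreover have "inj (\<lambda>a. w \<cdot> a)"
  proof (rule injI)
    fix a b assume "w \<cdot> a = w \<cdot> b"
    hence "w \<cdot> (a - b) = 0"
      using V.rscale_add[of w "a - b" b] by simp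
    hence "w \<cdot> (a - b) \<cdot> inverse (a - b) = 0" by simp
    with assms show "a = b"
      by (metis V_rscale_inverse(1) right_minus_eq)
  qed
  ultimately show ?thesis
    using P.dim_image_eq[of "\<lambda>a. w \<cdot> a" UNIV] by simp
qed

text \<open>Nonzero scalars are invertible, so a line that meets \<open>W\<close> outside 0 lies in
  \<open>W\<close>. Hence the sum is direct.\<close>

lemma dim_add_line:
  assumes W: "V.subspace W" and w: "w \<notin> W"
  shows "VF.dim {x + y |x y. x \<in> W \<and> y \<in> range (\<lambda>a. w \<cdot> a)} = VF.dim W + d"
proof -
  let ?L = "range (\<lambda>a. w \<cdot> a)"
  have "W \<inter> ?L \<subseteq> {0}"
  proof safe
    fix a assume a: "w \<cdot> a \<in> W"
    show "w \<cdot> a = 0"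
    proof (rule ccontr)
      assume "w \<cdot> a \<noteq> 0"
      hence "a \<noteq> 0" by auto
      thus False using V_subspaceD(6)[OF W] a w by blast
    qed
  qed
  hence 0: "VF.dim (W \<inter> ?L) = 0" unfolding VF.dim_eq_0 .
  have "w \<noteq> 0" using w V_subspaceD(1)[OF W] by auto
  thus ?thesis
    using VF.dim_sums_Int[OF VF_subspace[OF W] VF_subspace[OF V_subspace_line[of w]], unfolded 0]
    by (simp add: dim_line)
qed

lemma dim_psubset_add:
  assumes "V.subspace W'" "V.subspace W" "W' \<subset> W"
  shows "VF.dim W' + d \<le> VF.dim W"
proof -
  obtain w where w: "w \<in> W" "w \<notin> W'" using assms(3) by blast
  have "{x + y |x y. x \<in> W' \<and> y \<in> range (\<lambda>a. w \<cdot> a)} \<subseteq> W"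
    using assms w by (auto intro!: V_subspaceD(2,3)[OF assms(2)])
  from VF.dim_subset[OF this] show ?thesis
    using dim_add_line[OF assms(1) w(2)] by simp
qed

text \<open>\<open>W\<close> is reached from \<open>{0}\<close> by adding lines, each of which
  contributes exactly \<open>d\<close>.\<close>

lemma dim_dvd:
  assumes "V.subspace W"
  shows "d dvd VF.dim W"
proof -
  have "d dvd VF.dim W" if "V.subspace W'" "W' \<subseteq> W" "d dvd VF.dim W'" for W'
    using that
  proof (induction "VF.dim W - VF.dim W'" arbitrary: W' rule: less_induct)
    case less
    show ?case
    proof (cases "W' = W")
      case False
      then obtain w where w: "w \<in> W" "w \<notin> W'" using less.prems by blast
      let ?W = "{x + y |x y. x \<in> W' \<and> y \<in> range (\<lambda>a. w \<cdot> a)}"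
      have "?W \<subseteq> W"
        using assms w less.prems by (auto intro!: V_subspaceD(2,3)[OF assms])
      moreover have "V.subspace ?W"
        by (intro V_subspace_sums less.prems V_subspace_line)
      moreover have "VF.dim ?W = VF.dim W' + d"
        using less.prems w by (intro dim_add_line)
      ultimately show ?thesis
        using less.hyps[of ?W] less.prems(3) VF.dim_subset[of ?W W] d_pos
        by (simp add: less.prems)
    qed (use less.prems in simp)
  qed
  from this[of "{0}"] show ?thesis
    using assms by (simp add: V_subspace_0 V_subspaceD)
qed

section \<open>Spans, independent sets and bases over the division ring\<close>

lemma V_span_subspace: "V.subspace (V.span B)"
  unfolding V.span_def hull_def V.subspace_def by blast

lemma V_span_superset: "B \<subseteq> V.span B"
  unfolding V.span_def by (rule hull_subset)

lemma V_span_minimal: "B \<subseteq> W \<Longrightarrow> V.subspace W \<Longrightarrow> V.span B \<subseteq> W"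
  unfolding V.span_def by (rule hull_minimal)

lemma sum_in_V_subspace: "V.subspace W \<Longrightarrow> (\<And>x. x \<in> A \<Longrightarrow> g x \<in> W) \<Longrightarrow> sum g A \<in> W"
  by (induction A rule: infinite_finite_induct) (auto simp: V_subspaceD)

lemma V_span_insert: "V.span (insert w B) = {x + y |x y. x \<in> V.span B \<and> y \<in> range (\<lambda>a. w \<cdot> a)}"
  (is "_ = ?S")
proof
  have "b \<in> ?S" if "b \<in> insert w B" for b
  proof (cases "b = w")
    case True
    have "w = 0 + w \<cdot> 1" by (simp add: V.rscale_one)
    thus ?thesis using True V_subspaceD(1)[OF V_span_subspace] by blast
  next
    case False
    hence "b = b + w \<cdot> 0" "b \<in> V.span B" using that V_span_superset by auto
    thus ?thesis by blast
  qed
  thus "V.span (insert w B) \<subseteq> ?S"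
    by (intro V_span_minimal V_subspace_sums V_span_subspace V_subspace_line subsetI)
  have "V.span B \<subseteq> V.span (insert w B)"
    using V_span_superset[of "insert w B"] by (intro V_span_minimal V_span_subspace) auto
  moreover have "w \<in> V.span (insert w B)"
    using V_span_superset by blast
  ultimately show "?S \<subseteq> V.span (insert w B)"
    by (auto intro!: V_subspaceD(2,3)[OF V_span_subspace])
qed

lemma V_span_explicit:
  assumes "finite B"
  shows "v \<in> V.span B \<longleftrightarrow> (\<exists>c. v = (\<Sum>b\<in>B. b \<cdot> c b))"
  using assms
proof (induction B arbitrary: v)
  case empty
  have "V.span {} = {0}"
    using V_span_minimal[of "{}" "{0}"] V_subspaceD(1)[OF V_span_subspace[of "{}"]]
    by (auto simp: V_subspace_0)
  thus ?case by simp
next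
  case (insert w B)
  show ?case
  proof
    assume "v \<in> V.span (insert w B)"
    then obtain c a where "v = (\<Sum>b\<in>B. b \<cdot> c b) + w \<cdot> a"
      using insert.IH by (auto simp: V_span_insert)
    also have "\<dots> = (\<Sum>b\<in>insert w B. b \<cdot> (c(w := a)) b)"
      using insert.hyps by (auto simp: add.commute intro!: sum.cong)
    finally show "\<exists>c. v = (\<Sum>b\<in>insert w B. b \<cdot> c b)" by blast
  next
    assume "\<exists>c. v = (\<Sum>b\<in>insert w B. b \<cdot> c b)"
    thus "v \<in> V.span (insert w B)"
      using V_span_superset[of "insert w B"] V_span_subspace[of "insert w B"]
      by (auto intro!: sum_in_V_subspace V_subspaceD(2,3) simp del: sum.insert)
  qed
qed

lemma V_independent_insert:
  assumes "V.independent B" "w \<notin> V.span B"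
  shows "V.independent (insert w B)"
  unfolding V.independent_def
proof (intro allI impI)
  fix A c assume A: "finite A" "A \<subseteq> insert w B" and sum: "(\<Sum>x\<in>A. x \<cdot> c x) = 0"
  have B: "\<forall>x\<in>A'. c x = 0" if "A' \<subseteq> A" "A' \<subseteq> B" "(\<Sum>x\<in>A'. x \<cdot> c x) = 0" for A'
    using assms(1) that finite_subset[OF _ A(1)] unfolding V.independent_def by blast
  show "\<forall>x\<in>A. c x = 0"
  proof (cases "w \<in> A")
    case True
    let ?s = "\<Sum>x\<in>A - {w}. x \<cdot> c x"
    have eq: "w \<cdot> c w = - ?s"
      using sum A True by (simp add: sum.remove eq_neg_iff_add_eq_0)
    have "?s \<in> V.span B"
      using A V_span_superset by (intro sum_in_V_subspace V_subspaceD(3) V_span_subspace) auto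
    hence "w \<cdot> c w \<in> V.span B"
      unfolding eq by (rule V_subspaceD(4)[OF V_span_subspace])
    hence "c w = 0"
      using assms(2) V_subspaceD(6)[OF V_span_subspace] by blast
    moreover from this eq have "?s = 0" by simp
    ultimately show ?thesis
      using B[of "A - {w}"] A by auto
  next
    case False
    thus ?thesis using B[of A] A sum by auto
  qed
qed

lemma V_independent_subset: "V.independent B \<Longrightarrow> B' \<subseteq> B \<Longrightarrow> V.independent B'"
  unfolding V.independent_def by blast

lemma dim_V_span:
  assumes "finite B" "V.independent B"
  shows "VF.dim (V.span B) = card B * d"
  using assms
proof (induction B)
  case empty
  show ?case
    using V_span_minimal[of "{}" "{0}"] by (auto simp: V_subspace_0)
next
  case (insert w B)
  have "w \<notin> V.span B"
  proof
    assume "w \<in> V.span B"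
    then obtain c where "w = (\<Sum>b\<in>B. b \<cdot> c b)"
      using V_span_explicit[OF insert.hyps(1)] by blast
    moreover have "(\<Sum>b\<in>B. b \<cdot> (c(w := - 1)) b) = (\<Sum>b\<in>B. b \<cdot> c b)"
      using insert.hyps by (intro sum.cong) auto
    ultimately have "(\<Sum>b\<in>insert w B. b \<cdot> (c(w := - 1)) b) = 0"
      using insert.hyps by (simp add: V_rscale_minus V.rscale_one)
    hence "(c(w := - 1)) w = 0"
      using insert.prems insert.hyps(1) unfolding V.independent_def by blast
    thus False by simp
  qed
  thus ?case
    using insert V_independent_subset[OF insert.prems, of B]
    by (simp add: V_span_insert dim_add_line V_span_subspace subset_insertI)
qed

lemma V_basis_finite:
  assumes "V.independent B"
  shows "finite B"
proof (rule ccontr)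
  assume "infinite B"
  then obtain A where A: "A \<subseteq> B" "finite A" "card A = Suc (VF.dim UNIV)"
    by (metis infinite_arbitrarily_large)
  have "card A * d \<le> VF.dim UNIV"
    using dim_V_span[OF A(2) V_independent_subset[OF assms A(1)]] VF.dim_subset[of "V.span A" UNIV]
    by simp
  moreover have "card A * 1 \<le> card A * d" using d_pos by (intro mult_le_mono) auto
  ultimately show False using A(3) by simp
qed

lemma V_dimension: "VF.dim UNIV = V.dimension * d"
proof -
  have ex: "\<exists>B. V.basis B"
  proof (rule ccontr)
    assume no: "\<nexists>B. V.basis B"
    \<comment> \<open>Without a basis every finite independent set could be enlarged, and the span
      would outgrow the finite dimension over the central subfield.\<close>
    have "\<exists>B. V.independent B \<and> finite B \<and> card B = k" for k
    proof (induction k)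
      case 0
      show ?case by (rule exI[of _ "{}"]) (simp add: V.independent_def)
    next
      case (Suc k)
      then obtain B where B: "V.independent B" "finite B" "card B = k" by blast
      with no obtain w where w: "w \<notin> V.span B" unfolding V.basis_def by blast
      hence "w \<notin> B" using V_span_superset by blast
      thus ?case
        using V_independent_insert[OF B(1) w] B by (intro exI[of _ "insert w B"]) simp
    qed
    then obtain B where B: "V.independent B" "finite B" "card B = Suc (VF.dim UNIV)" by blast
    have "card B * d \<le> VF.dim UNIV"
      using dim_V_span[OF B(2,1)] VF.dim_subset[of "V.span B" UNIV] by simp
    moreover have "card B * 1 \<le> card B * d" using d_pos by (intro mult_le_mono) auto
    ultimately show False using B(3) by simp
  qed
  hence "V.basis (SOME B. V.basis B)" by (rule someI_ex)
  thus ?thesis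
    using dim_V_span[OF V_basis_finite] unfolding V.basis_def V.dimension_def by metis
qed

text \<open>The image of such a projection realises the quotient by \<open>K\<close> inside the space itself.\<close>

lemma exists_projection:
  assumes "V.subspace K"
  obtains \<pi> where "\<And>x y. \<pi> (x + y) = \<pi> x + \<pi> y" "\<And>x a. \<pi> (x \<cdot> a) = \<pi> x \<cdot> a"
    "\<And>x. \<pi> x = 0 \<longleftrightarrow> x \<in> K" "\<And>x. \<pi> (\<pi> x) = \<pi> x"
proof -
  have "\<exists>\<pi>. (\<forall>x y. \<pi> (x + y) = \<pi> x + \<pi> y) \<and> (\<forall>x a. \<pi> (x \<cdot> a) = \<pi> x \<cdot> a) \<and>
    (\<forall>x. \<pi> x = 0 \<longleftrightarrow> x \<in> K) \<and> (\<forall>x. \<pi> (\<pi> x) = \<pi> x)"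
    using assms
  proof (induction "VF.dim UNIV - VF.dim K" arbitrary: K rule: less_induct)
    case less
    show ?case
    proof (cases "K = UNIV")
      case True
      thus ?thesis by (intro exI[of _ "\<lambda>_. 0"]) simp
    next
      case False
      then obtain w where w: "w \<notin> K" by blast
      define K' where "K' = {x + y |x y. x \<in> K \<and> y \<in> range (\<lambda>a. w \<cdot> a)}"
      have K': "V.subspace K'" unfolding K'_def
        by (intro V_subspace_sums less.prems V_subspace_line)
      have "VF.dim K' = VF.dim K + d" unfolding K'_def
        using less.prems w by (intro dim_add_line)
      hence "VF.dim UNIV - VF.dim K' < VF.dim UNIV - VF.dim K"
        using VF.dim_subset[of K' UNIV] d_pos by simp
      from less.hyps[OF this K'] obtain \<pi> where \<pi>: "\<And>x y. \<pi> (x + y) = \<pi> x + \<pi> y"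
        "\<And>x a. \<pi> (x \<cdot> a) = \<pi> x \<cdot> a" "\<And>x. \<pi> x = 0 \<longleftrightarrow> x \<in> K'" "\<And>x. \<pi> (\<pi> x) = \<pi> x"
        by blast
      have \<pi>_diff: "\<pi> (x - y) = \<pi> x - \<pi> y" for x y
        using \<pi>(1)[of "x - y" y] by simp
      have uniq: "a = b" if "x - w \<cdot> a \<in> K" "x - w \<cdot> b \<in> K" for x a b
      proof (rule ccontr)
        assume "a \<noteq> b"
        have "(x - w \<cdot> b) - (x - w \<cdot> a) = w \<cdot> (a - b)"
          using V.rscale_add[of w "a - b" b] by simp
        hence "w \<cdot> (a - b) \<in> K"
          using V_subspaceD(5)[OF less.prems that(2,1)] by simp
        thus False
          using V_subspaceD(6)[OF less.prems] \<open>a \<noteq> b\<close> w by simp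
      qed
      have "\<exists>a. (x - \<pi> x) - w \<cdot> a \<in> K" for x
      proof -
        have "x - \<pi> x \<in> K'" using \<pi>(3)[of "x - \<pi> x"] by (simp add: \<pi>_diff \<pi>(4))
        then obtain k a where "k \<in> K" "x - \<pi> x = k + w \<cdot> a" unfolding K'_def by blast
        thus ?thesis by (intro exI[of _ a]) simp
      qed
      \<comment> \<open>\<open>r x\<close> is the coordinate of \<open>x - \<pi> x\<close> along
        \<open>w\<close>, taken modulo \<open>K\<close>. Adding \<open>w \<cdot> r x\<close> to
        \<open>\<pi> x\<close> shrinks the kernel from \<open>K'\<close> to
        \<open>K\<close>.\<close>
      then obtain r where r: "\<And>x. (x - \<pi> x) - w \<cdot> r x \<in> K" by metis
      have rI: "r x = a" if "(x - \<pi> x) - w \<cdot> a \<in> K" for x a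
        using uniq[OF r that] .
      have r_add: "r (x + y) = r x + r y" for x y
        using V_subspaceD(2)[OF less.prems r[of x] r[of y]]
        by (intro rI) (simp add: \<pi>(1) V.rscale_add algebra_simps)
      have r_scale: "r (x \<cdot> a) = r x * a" for x a
        using V_subspaceD(3)[OF less.prems r[of x], of a]
        by (intro rI) (simp add: \<pi>(2) V_diff_rscale V.rscale_rscale)
      have wK': "w \<in> K'"
        using V_subspaceD(1)[OF less.prems] unfolding K'_def
        by (force simp: V.rscale_one intro!: range_eqI[of _ _ 1])
      have KK': "x \<in> K'" if "x \<in> K" for x
        unfolding K'_def using that by (force intro!: range_eqI[of _ _ 0])
      define \<rho> where "\<rho> x = \<pi> x + w \<cdot> r x" for x
      have "\<rho> (x + y) = \<rho> x + \<rho> y" for x y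
        by (simp add: \<rho>_def r_add \<pi>(1) V.rscale_add)
      moreover have "\<rho> (x \<cdot> a) = \<rho> x \<cdot> a" for x a
        by (simp add: \<rho>_def r_scale \<pi>(2) V.add_rscale V.rscale_rscale)
      moreover have \<pi>w: "\<pi> (w \<cdot> a) = 0" for a
        using \<pi>(3) V_subspaceD(3)[OF K' wK'] by blast
      have "\<rho> x = 0 \<longleftrightarrow> x \<in> K" for x
      proof
        assume "\<rho> x = 0"
        hence "x = (x - \<pi> x) - w \<cdot> r x" by (simp add: \<rho>_def algebra_simps)
        thus "x \<in> K" using r by metis
      next
        assume x: "x \<in> K"
        hence "\<pi> x = 0" using \<pi>(3) KK' by blast
        moreover from this have "r x = 0" using x by (intro rI) simp
        ultimately show "\<rho> x = 0" by (simp add: \<rho>_def)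
      qed
      moreover have "\<rho> (\<rho> x) = \<rho> x" for x
      proof -
        have 1: "\<pi> (\<rho> x) = \<pi> x" by (simp add: \<rho>_def \<pi>(1,4) \<pi>w)
        have "r (\<rho> x) = r x"
          unfolding rI[of "\<rho> x" "r x"] using V_subspaceD(1)[OF less.prems]
          by (intro rI) (simp only: 1, simp add: \<rho>_def)
        thus ?thesis using 1 by (simp add: \<rho>_def)
      qed
      ultimately show ?thesis by blast
    qed
  qed
  thus ?thesis using that by blast
qed

end

section \<open>Operator spaces of maximal rank\<close>

lemma \<alpha>_0 [simp]: "\<alpha> 0 d = 0"
  by (simp add: \<alpha>_def)

text \<open>The increment is the largest rank that intransitivity allows in dimension
  \<open>Suc k\<close>. This is how \<alpha> enters the induction on
  \<open>dim S = rk S x + dim (vanishing S x)\<close>.\<close>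

lemma \<alpha>_Suc: "\<alpha> (Suc k) d = \<alpha> k d + int (Suc k * d) - 1"
proof -
  have "Suc k choose 2 = k + (k choose 2)"
    by (simp add: numeral_2_eq_2)
  thus ?thesis by (simp add: \<alpha>_def algebra_simps)
qed

lemma \<alpha>_mono:
  assumes "d > 0" "k \<le> m"
  shows "\<alpha> k d \<le> \<alpha> m d"
  using assms(2)
proof (induction m rule: dec_induct)
  case (step m)
  have "0 < Suc m * d" using assms(1) by simp
  hence "1 \<le> int (Suc m * d)" by linarith
  thus ?case using step.IH by (simp only: \<alpha>_Suc)
qed simp

context division_ring_spaces
begin

abbreviation scH :: "'f \<Rightarrow> ('u \<Rightarrow> 'v) \<Rightarrow> 'u \<Rightarrow> 'v"
  where "scH \<equiv> pointwise_scale (restrict_scalars \<iota> sV)"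

abbreviation rk :: "('u \<Rightarrow> 'v) set \<Rightarrow> 'u \<Rightarrow> nat"
  where "rk S x \<equiv> VF.dim (eval_at S x)"

abbreviation many_scalars :: "nat \<Rightarrow> bool"
  where "many_scalars m \<equiv> infinite (range \<iota>) \<or> m \<le> card (range \<iota>)"

lemma many_scalars_iff:
  "many_scalars m \<longleftrightarrow> infinite (UNIV :: 'f set) \<or> m \<le> card (UNIV :: 'f set)"
  using central_subfield_inj[OF central] by (simp add: finite_image_iff card_image)

definition operator_space :: "('u \<Rightarrow> 'v) set \<Rightarrow> bool"
  where "operator_space S \<longleftrightarrow> S \<subseteq> Hom sU sV \<and> H.subspace S"

definition vanishing :: "('u \<Rightarrow> 'v) set \<Rightarrow> 'u \<Rightarrow> ('u \<Rightarrow> 'v) set"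
  where "vanishing S x = {f \<in> S. f x = 0}"

text \<open>The largest \<open>'d\<close>-linear subspace contained in the \<open>'f\<close>-linear subspace \<open>A\<close>.\<close>

definition core :: "'v set \<Rightarrow> 'v set"
  where "core A = {v. \<forall>a. v \<cdot> a \<in> A}"

definition max_rank :: "('u \<Rightarrow> 'v) set \<Rightarrow> 'u \<Rightarrow> bool"
  where "max_rank S x \<longleftrightarrow> (\<forall>y. rk S y \<le> rk S x)"

text \<open>Deep intransitivity relative to a codomain \<open>W\<close> that is a subspace and not a
  type, so that inductions can pass to smaller codomains. For \<open>W \<noteq> {0}\<close> the case
  \<open>W' = W\<close> is intransitivity itself; \<open>W = {0}\<close> is allowed and serves as
  the base of the inductions.\<close>

definition deep :: "('u \<Rightarrow> 'v) set \<Rightarrow> 'v set \<Rightarrow> bool"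
  where "deep S W \<longleftrightarrow> operator_space S \<and> V.subspace W \<and> (\<forall>f\<in>S. range f \<subseteq> W) \<and>
    (\<forall>W'. V.subspace W' \<longrightarrow> W' \<noteq> {0} \<longrightarrow> W' \<subseteq> W \<longrightarrow> intransitive (maps_into S W') W')"

lemma eval_at_image: "eval_at S x = (\<lambda>f. f x) ` S"
  by (auto simp: eval_at_def)

lemma eval_atI [intro]: "f \<in> S \<Longrightarrow> f x \<in> eval_at S x"
  by (auto simp: eval_at_def)

lemma eval_atE: "v \<in> eval_at S x \<Longrightarrow> (\<And>f. f \<in> S \<Longrightarrow> v = f x \<Longrightarrow> P) \<Longrightarrow> P"
  by (auto simp: eval_at_def)

lemma eval_at_mono: "S \<subseteq> T \<Longrightarrow> eval_at S x \<subseteq> eval_at T x"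
  by (auto simp: eval_at_def)

lemma scH_apply: "scH c f x = f x \<cdot> \<iota> c"
  by (simp add: pointwise_scale_def restrict_scalars_def)

lemma linear_eval: "Vector_Spaces.linear scH (restrict_scalars \<iota> sV) (\<lambda>f. f x)"
  unfolding Vector_Spaces.linear_iff using H.vector_space_axioms VF.vector_space_axioms
  by (simp add: VF_scale_eq scH_apply)

lemma vanishingD: "f \<in> vanishing S x \<Longrightarrow> f \<in> S" "f \<in> vanishing S x \<Longrightarrow> f x = 0"
  by (auto simp: vanishing_def)

context
  fixes S assumes S: "operator_space S"
begin

lemma operator_add: "f \<in> S \<Longrightarrow> f (x + y) = f x + f y"
  and operator_rscale: "f \<in> S \<Longrightarrow> f (sU x a) = f x \<cdot> a"
  using S by (auto simp: operator_space_def Hom_def)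

lemma space_add: "f \<in> S \<Longrightarrow> g \<in> S \<Longrightarrow> f + g \<in> S"
  and space_diff: "f \<in> S \<Longrightarrow> g \<in> S \<Longrightarrow> f - g \<in> S"
  and space_scale: "f \<in> S \<Longrightarrow> scH c f \<in> S"
  and space_0: "0 \<in> S"
  using S by (auto simp: operator_space_def H.subspace_add H.subspace_diff H.subspace_scale H.subspace_0)

lemma eval_at_subspace: "VF.subspace (eval_at S x)"
  unfolding eval_at_image using S
  by (intro ev.linear_subspace_image linear_eval) (simp add: operator_space_def)

lemma operator_space_vanishing: "operator_space (vanishing S x)"
  unfolding operator_space_def
proof
  show "vanishing S x \<subseteq> Hom sU sV"
    using S by (auto simp: operator_space_def vanishing_def)
  show "H.subspace (vanishing S x)"
    by (rule H.subspaceI) (auto simp: vanishing_def space_add space_scale space_0 scH_apply)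
qed

lemma operator_space_maps_into:
  assumes "V.subspace W"
  shows "operator_space (maps_into S W)"
  unfolding operator_space_def
proof
  show "maps_into S W \<subseteq> Hom sU sV"
    using S by (auto simp: operator_space_def maps_into_def)
  show "H.subspace (maps_into S W)"
    by (rule H.subspaceI)
      (auto simp: maps_into_def space_add space_scale space_0 scH_apply image_subset_iff V_subspaceD[OF assms])
qed

text \<open>The range of a linear map is closed under all scalars, so it cannot lie in
  \<open>A\<close> without lying in the core.\<close>

lemma range_subspace_core:
  assumes "f \<in> S" "\<And>z. f z \<in> A"
  shows "range f \<subseteq> core A"
  using assms(2) by (auto simp: core_def simp flip: operator_rscale[OF assms(1)])

lemma dim_operator_space:
  assumes "finite B" "vanishing S x \<subseteq> H.span B"
  shows "\<exists>B. finite B \<and> S \<subseteq> H.span B" "H.dim S = rk S x + H.dim (vanishing S x)"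
  using ev.rank_nullity_on[OF linear_eval _ assms(1) _ VF.finite_Basis, of S x] S assms(2)
  by (simp_all add: eval_at_image vanishing_def operator_space_def VF.span_Basis)

lemma rank_le_dim:
  assumes "finite B" "S \<subseteq> H.span B"
  shows "H.dim S = rk S x + H.dim (vanishing S x)"
  using assms by (intro dim_operator_space[of B]) (auto simp: vanishing_def)

text \<open>Let \<open>g\<close> be a linear section of evaluation at \<open>x\<close>. At
  \<open>x s + z\<close> the map \<open>g v\<close> takes the value \<open>v s + g v z\<close>, and
  \<open>exists_injective_perturbation\<close> provides an \<open>s\<close> for which this is
  injective in \<open>v\<close> and misses \<open>u\<close>. The choice \<open>u = 0\<close> means
  that there is nothing to miss.\<close>

lemma exists_subspace_on_line:
  assumes "many_scalars (Suc (rk S x))" "u \<notin> eval_at S x \<or> u = 0"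
  obtains s E where "E \<subseteq> eval_at S (sU x (\<iota> s) + z)" "VF.subspace E" "VF.dim E = rk S x"
    "u \<notin> E \<or> u = 0"
proof -
  interpret VV: finite_dimensional_vector_space_pair "restrict_scalars \<iota> sV" BV "restrict_scalars \<iota> sV" BV ..
  have "H.subspace S" using S by (simp add: operator_space_def)
  from ev.linear_exists_right_inverse_on[OF linear_eval this, of x]
  obtain g where g: "range g \<subseteq> S" "Vector_Spaces.linear (restrict_scalars \<iota> sV) scH g"
    "\<And>v. v \<in> eval_at S x \<Longrightarrow> g v x = v"
    by (auto simp: eval_at_image)
  interpret g: Vector_Spaces.linear "restrict_scalars \<iota> sV" scH g by fact
  have lin: "Vector_Spaces.linear (restrict_scalars \<iota> sV) (restrict_scalars \<iota> sV) (\<lambda>v. g v z)"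
    using Vector_Spaces.linear_compose[OF g(2) linear_eval[of z]] by (simp add: o_def)
  have "infinite (UNIV :: 'f set) \<or> VF.dim (eval_at S x) < card (UNIV :: 'f set)"
    using assms(1) unfolding many_scalars_iff by (simp add: Suc_le_eq)
  then obtain s where s: "\<And>v k. v \<in> eval_at S x \<Longrightarrow>
      restrict_scalars \<iota> sV s v + g v z = restrict_scalars \<iota> sV k u \<Longrightarrow> v = 0"
    using VF.exists_injective_perturbation[OF lin eval_at_subspace assms(2)] by metis
  define m where "m v = restrict_scalars \<iota> sV s v + g v z" for v
  have lin_m: "Vector_Spaces.linear (restrict_scalars \<iota> sV) (restrict_scalars \<iota> sV) m"
    unfolding m_def by (intro VV.linear_compose_add lin VF.linear_scale_self)
  interpret m: Vector_Spaces.linear "restrict_scalars \<iota> sV" "restrict_scalars \<iota> sV" m by fact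
  have m_eq: "m v = g v (sU x (\<iota> s) + z)" if "v \<in> eval_at S x" for v
    using g(1) g(3)[OF that] by (simp add: m_def VF_scale_eq operator_add operator_rscale image_subset_iff)
  have "m v = 0 \<Longrightarrow> v = 0" if "v \<in> eval_at S x" for v
    using s[OF that, of 0] unfolding m_def by simp
  hence inj: "inj_on m (eval_at S x)"
    using VV.linear_inj_on_iff_eq_0[OF lin_m eval_at_subspace] by blast
  show ?thesis
  proof (rule that[of "m ` eval_at S x" s])
    show "m ` eval_at S x \<subseteq> eval_at S (sU x (\<iota> s) + z)"
      using g(1) m_eq by (auto simp: eval_atI image_subset_iff)
    show "VF.subspace (m ` eval_at S x)"
      by (intro m.subspace_image eval_at_subspace)
    show "VF.dim (m ` eval_at S x) = rk S x"
      using inj eval_at_subspace by (intro VV.dim_image_eq lin_m) (simp add: VF.span_eq_iff[THEN iffD2])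
    show "u \<notin> m ` eval_at S x \<or> u = 0"
    proof (cases "u = 0")
      case False
      have "u \<notin> m ` eval_at S x"
      proof
        assume "u \<in> m ` eval_at S x"
        then obtain v where v: "v \<in> eval_at S x" "u = m v" by blast
        hence "v = 0" using s[OF v(1), of 1] unfolding m_def by simp
        with v False show False by simp
      qed
      thus ?thesis by simp
    qed simp
  qed
qed

lemma exists_rank_ge_on_line:
  assumes "many_scalars (Suc (rk S x))"
  obtains s where "rk S x \<le> rk S (sU x (\<iota> s) + z)"
  using exists_subspace_on_line[OF assms, of 0 z] VF.dim_subset by metis

context
  fixes x assumes x: "max_rank S x" "many_scalars (Suc (rk S x))"
begin

text \<open>If \<open>v\<close> were outside \<open>S x\<close>, then for some \<open>s\<close> the
  space \<open>S (x s + z)\<close> would contain \<open>v\<close> together with a space of dimension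
  \<open>rk S x\<close> that misses \<open>v\<close>, against maximality of the rank.\<close>

lemma in_eval_at_of_line:
  assumes "\<And>s. v \<in> eval_at S (sU x (\<iota> s) + z)"
  shows "v \<in> eval_at S x"
proof (rule ccontr)
  assume v: "v \<notin> eval_at S x"
  obtain s E where E: "E \<subseteq> eval_at S (sU x (\<iota> s) + z)" "VF.subspace E" "VF.dim E = rk S x"
    "v \<notin> E \<or> v = 0"
    by (rule exists_subspace_on_line[OF x(2) disjI1[OF v], of z])
  have "v \<noteq> 0"
    using v VF.subspace_0[OF eval_at_subspace[of x]] by auto
  with E have "VF.dim (insert v E) = Suc (rk S x)"
    by (simp add: VF.dim_insert VF.span_eq_iff[THEN iffD2])
  moreover have "VF.dim (insert v E) \<le> rk S (sU x (\<iota> s) + z)"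
    using assms E(1) by (intro VF.dim_subset) auto
  moreover have "\<dots> \<le> rk S x"
    using x(1) by (simp add: max_rank_def)
  ultimately show False by simp
qed

text \<open>A map that kills \<open>x\<close> is constant along the line
  \<open>x s + z\<close>.\<close>

lemma vanishing_eval_in:
  assumes "f \<in> vanishing S x"
  shows "f z \<in> eval_at S x"
proof (rule in_eval_at_of_line)
  fix s
  have f: "f \<in> S" "f x = 0" using assms by (auto simp: vanishing_def)
  hence "f z = f (sU x (\<iota> s) + z)"
    by (simp add: operator_add operator_rscale)
  thus "f z \<in> eval_at S (sU x (\<iota> s) + z)" using f(1) by auto
qed

text \<open>On the line \<open>x s + z\<close>, the operators \<open>g - s f\<close> and \<open>h - s g + s\<^sup>2 f\<close> take the values \<open>g z\<close>
  and \<open>h z\<close>.\<close>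

lemma second_order:
  assumes "f \<in> vanishing S x" "g \<in> S" "f z = g x"
  shows "g z \<in> eval_at S x"
proof (rule in_eval_at_of_line)
  fix s
  have f: "f \<in> S" "f x = 0" using assms by (auto simp: vanishing_def)
  have "(g - scH s f) (sU x (\<iota> s) + z) = g z"
    using f assms by (simp add: scH_apply operator_add operator_rscale)
  thus "g z \<in> eval_at S (sU x (\<iota> s) + z)"
    using f(1) assms(2) by (metis eval_atI space_diff space_scale)
qed

lemma third_order:
  assumes "f \<in> vanishing S x" "g \<in> S" "f z = g x" "h \<in> S" "g z = h x"
  shows "h z \<in> eval_at S x"
proof (rule in_eval_at_of_line)
  fix s
  have f: "f \<in> S" "f x = 0" using assms by (auto simp: vanishing_def)
  have "(h - scH s (g - scH s f)) (sU x (\<iota> s) + z) = h z"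
    using f assms by (simp add: scH_apply operator_add operator_rscale V.add_rscale V_diff_rscale V.rscale_rscale)
  thus "h z \<in> eval_at S (sU x (\<iota> s) + z)"
    using f(1) assms(2,4) by (metis eval_atI space_diff space_scale)
qed

lemma vanishing_range: "f \<in> vanishing S x \<Longrightarrow> range f \<subseteq> core (eval_at S x)"
  by (intro range_subspace_core vanishing_eval_in) (auto simp: vanishing_def)

end

end

section \<open>Cores, deep spaces and the general dimension bound\<close>

lemma core_subset: "core A \<subseteq> A"
  by (force simp: core_def V.rscale_one dest: spec[of _ 1])

lemma V_subspace_core:
  assumes "VF.subspace A"
  shows "V.subspace (core A)"
  using assms unfolding V.subspace_def core_def
  by (auto simp: V.add_rscale V.rscale_rscale VF.subspace_add VF.subspace_0)

lemma exists_max_rank: obtains x where "max_rank S x"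
proof -
  have "\<forall>y. rk S y \<le> VF.dim UNIV"
    by (simp add: VF.dim_subset)
  hence "\<exists>x. True \<and> (\<forall>y. True \<longrightarrow> rk S y \<le> rk S x)"
    by (intro ex_has_greatest_nat[where b = "Suc (VF.dim UNIV)" and k = undefined])
      (auto simp: less_Suc_eq_le)
  thus ?thesis using that by (auto simp: max_rank_def)
qed

lemma deep_subset:
  assumes "deep S W" "operator_space T" "T \<subseteq> S" "V.subspace W1" "W1 \<subseteq> W" "\<And>f. f \<in> T \<Longrightarrow> range f \<subseteq> W1"
  shows "deep T W1"
proof -
  have "intransitive (maps_into T W') W'" if W': "V.subspace W'" "W' \<noteq> {0}" "W' \<subseteq> W1" for W'
  proof -
    have "intransitive (maps_into S W') W'"
      using assms(1,5) W' unfolding deep_def by blast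
    moreover have "eval_at (maps_into T W') x \<subseteq> eval_at (maps_into S W') x" for x
      using assms(3) by (auto simp: maps_into_def eval_at_def)
    moreover have "eval_at (maps_into S W') x \<subseteq> W'" for x
      by (auto simp: maps_into_def eval_at_def)
    ultimately show ?thesis unfolding intransitive_def by blast
  qed
  thus ?thesis unfolding deep_def using assms(2,4,6) by (intro conjI ballI) simp_all
qed

lemma deepD:
  assumes "deep S W"
  shows "operator_space S" "V.subspace W" "f \<in> S \<Longrightarrow> f x \<in> W" "eval_at S x \<subseteq> W"
    "W \<noteq> {0} \<Longrightarrow> eval_at S x \<noteq> W"
proof -
  show "operator_space S" "V.subspace W" "f \<in> S \<Longrightarrow> f x \<in> W" "eval_at S x \<subseteq> W"
    using assms by (auto simp: deep_def eval_at_def)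
  have "maps_into S W = S" using assms by (auto simp: deep_def maps_into_def)
  thus "W \<noteq> {0} \<Longrightarrow> eval_at S x \<noteq> W"
    using assms unfolding deep_def intransitive_def by (metis order_refl)
qed

lemma deep_rank_less:
  assumes "deep S W" "VF.dim W > 0"
  shows "rk S x < VF.dim W"
proof -
  have "W \<noteq> {0}" using assms(2) by auto
  hence "eval_at S x \<subset> W" using deepD(4,5)[OF assms(1)] by blast
  thus ?thesis
    using VF.dim_psubset[of "eval_at S x" W] eval_at_subspace[OF deepD(1)[OF assms(1)]]
      VF_subspace[OF deepD(2)[OF assms(1)]] by (simp add: VF.span_eq_iff[THEN iffD2])
qed

text \<open>The step of the inductions: maps that kill a vector of maximal rank form a deep space
  whose codomain is the core, which is smaller by \<open>dim_core\<close>.\<close>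

lemma deep_vanishing:
  assumes "deep S W" "max_rank S x" "many_scalars (Suc (rk S x))"
  shows "deep (vanishing S x) (core (eval_at S x))"
proof (rule deep_subset[OF assms(1)])
  have S: "operator_space S" using deepD(1)[OF assms(1)] .
  show "operator_space (vanishing S x)" by (rule operator_space_vanishing[OF S])
  show "vanishing S x \<subseteq> S" by (auto simp: vanishing_def)
  show "V.subspace (core (eval_at S x))" by (intro V_subspace_core eval_at_subspace S)
  show "core (eval_at S x) \<subseteq> W"
    using core_subset deepD(4)[OF assms(1)] by (rule subset_trans)
  show "range f \<subseteq> core (eval_at S x)" if "f \<in> vanishing S x" for f
    using vanishing_range[OF S assms(2,3) that] .
qed

text \<open>The core has dimension divisible by \<open>d\<close> and at most \<open>rk S x\<close>,
  which is less than \<open>k * d\<close>; so it loses at least one dimension over the division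
  ring.\<close>

lemma dim_core:
  assumes "deep S W" "VF.dim W = k * d" "k > 0"
  obtains k' where "VF.dim (core (eval_at S x)) = k' * d" "k' < k"
proof -
  have core: "V.subspace (core (eval_at S x))"
    by (intro V_subspace_core eval_at_subspace deepD(1)[OF assms(1)])
  obtain k' where k': "VF.dim (core (eval_at S x)) = k' * d"
    using dim_dvd[OF core] by (metis dvdE mult.commute)
  have "VF.dim (core (eval_at S x)) \<le> rk S x"
    by (intro VF.dim_subset core_subset)
  also have "\<dots> < k * d"
    using deep_rank_less[OF assms(1)] assms d_pos by simp
  finally show ?thesis using k' that by auto
qed

text \<open>Finite generation is carried through the induction along with the bound, since the
  dimension formula for \<open>S\<close> rests on that of \<open>vanishing S x\<close>.\<close>

proposition dim_deep_le:
  assumes "deep S W" "VF.dim W = k * d" "many_scalars (k * d)"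
  shows "(\<exists>B. finite B \<and> S \<subseteq> H.span B) \<and> int (H.dim S) \<le> \<alpha> k d"
  using assms
proof (induction k arbitrary: S W rule: less_induct)
  case (less k)
  have S: "operator_space S" using less.prems deepD by blast
  show ?case
  proof (cases "k = 0")
    case True
    hence "W \<subseteq> {0}" using less.prems VF.dim_eq_0 by simp
    hence "f z = 0" if "f \<in> S" for f z
      using deepD(3)[OF less.prems(1) that, of z] by blast
    hence "S \<subseteq> {0}" by (auto simp: fun_eq_iff)
    hence "S \<subseteq> H.span {}" by simp
    moreover from this have "H.dim S = 0"
      using H.dim_le_card[of S "{}"] by simp
    ultimately show ?thesis
      using True by (intro conjI exI[of _ "{}"]) simp_all
  next
    case False
    then obtain m where m: "k = Suc m" using not0_implies_Suc by blast
    obtain x where x: "max_rank S x" by (rule exists_max_rank)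
    have r: "rk S x < k * d"
      using deep_rank_less[OF less.prems(1)] less.prems(2) False d_pos by simp
    hence big: "many_scalars (Suc (rk S x))" using less.prems(3) by auto
    obtain k' where k': "VF.dim (core (eval_at S x)) = k' * d" "k' < k"
      using dim_core[OF less.prems(1,2)] False by blast
    have "many_scalars (k' * d)"
      using less.prems(3) k'(2) by (meson le_trans less_or_eq_imp_le mult_le_mono1)
    from less.IH[OF k'(2) deep_vanishing[OF less.prems(1) x big] k'(1) this]
    obtain B where B: "finite B" "vanishing S x \<subseteq> H.span B"
      and dim: "int (H.dim (vanishing S x)) \<le> \<alpha> k' d" by blast
    \<comment> \<open>The worst case is a core of dimension \<open>m * d\<close> and rank
      \<open>k * d - 1\<close>, which add up to \<open>\<alpha> k d\<close> by
      \<open>\<alpha>_Suc\<close>.\<close>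
    have "\<alpha> k' d \<le> \<alpha> m d" using k'(2) m d_pos by (intro \<alpha>_mono) auto
    hence "int (H.dim S) \<le> \<alpha> k d"
      using dim_operator_space(2)[OF S B] dim r unfolding m \<alpha>_Suc by linarith
    thus ?thesis
      using dim_operator_space(1)[OF S B] by blast
  qed
qed

end

section \<open>Spaces of low transitive rank\<close>

context division_ring_spaces
begin

lemma span_insert_codim1:
  assumes "VF.subspace A" "A \<subseteq> W" "VF.dim W \<le> VF.dim A + 1"
  obtains w where "W \<subseteq> VF.span (insert w A)"
proof (cases "W \<subseteq> A")
  case True
  thus ?thesis using that[of 0] VF.span_superset[of A] by auto
next
  case False
  then obtain w where w: "w \<in> W" "w \<notin> A" by blast
  have "VF.dim (insert w A) = VF.dim A + 1"
    using w assms(1) by (simp add: VF.dim_insert VF.span_eq_iff[THEN iffD2])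
  hence "VF.span (insert w A) = VF.span W"
    using w assms by (intro VF.dim_eq_span) auto
  thus ?thesis using that[of w] VF.span_superset[of W] by simp
qed

text \<open>The sum is a subspace over the division ring strictly larger than \<open>W1\<close>, so
  it gains at least \<open>d\<close> dimensions and fills \<open>W\<close>.\<close>

lemma hyperplanes_sum:
  assumes "V.subspace W" "V.subspace W1" "V.subspace W2" "W1 \<subseteq> W" "W2 \<subseteq> W" "W1 \<noteq> W2"
    and "VF.dim W \<le> VF.dim W1 + d" "VF.dim W1 = VF.dim W2"
  shows "W = {x + y |x y. x \<in> W1 \<and> y \<in> W2}"
proof -
  let ?P = "{x + y |x y. x \<in> W1 \<and> y \<in> W2}"
  have P: "V.subspace ?P" using assms by (intro V_subspace_sums)
  have PW: "?P \<subseteq> W" using assms by (auto intro!: V_subspaceD(2)[OF assms(1)])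
  have 1: "W1 \<subseteq> ?P" using V_subspaceD(1)[OF assms(3)] by force
  have 2: "W2 \<subseteq> ?P" using V_subspaceD(1)[OF assms(2)] by force
  have "W1 \<noteq> ?P"
  proof
    assume "W1 = ?P"
    with 2 have "W2 \<subseteq> W1" by simp
    hence "W2 = W1"
      using assms(2,3,8) by (intro VF.subspace_dim_equal) (auto simp: VF_subspace)
    with assms(6) show False by simp
  qed
  hence "VF.dim W1 + d \<le> VF.dim ?P"
    using 1 by (intro dim_psubset_add assms P) auto
  hence "?P = W"
    using PW assms(7) by (intro VF.subspace_dim_equal VF_subspace P assms(1)) auto
  thus ?thesis by simp
qed

lemma vanishing_maps_into:
  assumes "\<And>f. f \<in> vanishing S x \<Longrightarrow> range f \<subseteq> W"
  shows "vanishing (maps_into S W) x = vanishing S x"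
  using assms by (auto simp: vanishing_def maps_into_def)

lemma eval_vanishing_line:
  assumes "operator_space S"
  shows "eval_at (vanishing S x) (sU x a + y) = eval_at (vanishing S x) y"
proof -
  have "f (sU x a + y) = f y" if "f \<in> vanishing S x" for f
    using that by (simp add: operator_add[OF assms] operator_rscale[OF assms] vanishing_def)
  thus ?thesis by (auto simp: eval_at_def) metis
qed

context
  fixes S W k
  assumes S: "deep S W" and W: "VF.dim W = k * d" and scalars: "many_scalars (k * d)" and k: "k > 0"
begin

lemma deep_rank_bound: "rk S x < k * d"
  using deep_rank_less[OF S] W k d_pos by simp

lemma deep_scalars: "many_scalars (Suc (rk S x))"
  using scalars deep_rank_bound[of x] by auto

lemma deep_dim: "H.dim S = rk S x + H.dim (vanishing S x)"
  using dim_deep_le[OF S W scalars] rank_le_dim[OF deepD(1)[OF S]] by blast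

lemma many_scalars_less: "k' < k \<Longrightarrow> many_scalars (k' * d)"
  using scalars by (meson le_trans less_or_eq_imp_le mult_le_mono1)

lemma V_subspace_core_eval: "V.subspace (core (eval_at S x))"
  by (intro V_subspace_core eval_at_subspace deepD(1)[OF S])

lemma core_eval_subset: "core (eval_at S x) \<subseteq> W"
  using core_subset deepD(4)[OF S] by (rule subset_trans)

lemma dim_le_of_core:
  assumes "max_rank S x" "VF.dim (core (eval_at S x)) = k' * d" "k' < k"
  shows "int (H.dim S) \<le> int (rk S x) + \<alpha> k' d"
  using dim_deep_le[OF deep_vanishing[OF S assms(1) deep_scalars] assms(2) many_scalars_less[OF assms(3)]]
    deep_dim[of x] by simp

text \<open>With a common core \<open>W1\<close>, the maps killing \<open>x\<close> and those
  killing \<open>y\<close> all lie in \<open>T\<close>, the maps of \<open>S\<close> into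
  \<open>W1\<close>. So \<open>dim T = rk T y + dim (vanishing S y)\<close> is bounded by
  \<open>\<alpha> k' d\<close>, while \<open>rk T y\<close> is at least \<open>k' * d - 1\<close>;
  this makes \<open>vanishing S y\<close> small.\<close>

lemma dim_le_of_same_core:
  assumes "max_rank S x" "max_rank S y" "core (eval_at S x) = core (eval_at S y)"
    and "VF.dim (core (eval_at S x)) = k' * d" "k' < k" "k' * d \<le> rk (vanishing S x) y + 1"
  shows "int (H.dim S) \<le> int (rk S x) + \<alpha> k' d - (int (k' * d) - 1)"
proof -
  have op: "operator_space S" using deepD(1)[OF S] .
  define W1 where "W1 = core (eval_at S x)"
  define T where "T = maps_into S W1"
  have W1: "V.subspace W1" unfolding W1_def by (rule V_subspace_core_eval)
  have T: "deep T W1"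
    using core_eval_subset[of x] unfolding T_def
    by (intro deep_subset[OF S] operator_space_maps_into op W1) (auto simp: W1_def maps_into_def)
  have x: "range f \<subseteq> W1" if "f \<in> vanishing S x" for f
    unfolding W1_def using vanishing_range[OF op assms(1) deep_scalars that] .
  have y: "range f \<subseteq> W1" if "f \<in> vanishing S y" for f
    unfolding W1_def assms(3) using vanishing_range[OF op assms(2) deep_scalars that] .
  note dimT = dim_deep_le[OF T assms(4)[folded W1_def] many_scalars_less[OF assms(5)]]
  have "H.dim T = rk T y + H.dim (vanishing S y)"
    using dimT rank_le_dim[OF deepD(1)[OF T], of _ y] vanishing_maps_into[OF y] unfolding T_def by metis
  moreover have "rk (vanishing S x) y \<le> rk T y"
    using x by (intro VF.dim_subset eval_at_mono) (auto simp: T_def maps_into_def vanishing_def)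
  moreover have "rk S x = rk S y"
    using assms(1,2) unfolding max_rank_def by (metis le_antisym)
  ultimately show ?thesis
    using deep_dim[of y] dimT assms(6) by linarith
qed

text \<open>The two cores span \<open>W\<close>. The core at \<open>y\<close> lies in
  \<open>S y\<close>, and so does a subspace of codimension at most 1 of the core at
  \<open>x\<close>, namely \<open>vanishing S x\<close> evaluated at \<open>y\<close>. Thus one more
  vector completes \<open>S y\<close> to \<open>W\<close>.\<close>

lemma rank_of_distinct_cores:
  assumes "max_rank S x" "core (eval_at S x) \<noteq> core (eval_at S y)"
    and "VF.dim (core (eval_at S x)) = (k - 1) * d" "VF.dim (core (eval_at S y)) = (k - 1) * d"
    and "(k - 1) * d \<le> rk (vanishing S x) y + 1"
  shows "k * d \<le> rk S y + 1"
proof -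
  have op: "operator_space S" using deepD(1)[OF S] .
  note Sx = operator_space_vanishing[OF op]
  have kd: "k * d = (k - 1) * d + d" using k by (cases k) auto
  have eq: "W = {u + v |u v. u \<in> core (eval_at S x) \<and> v \<in> core (eval_at S y)}"
    by (rule hyperplanes_sum[OF deepD(2)[OF S] V_subspace_core_eval V_subspace_core_eval
        core_eval_subset core_eval_subset assms(2)]) (simp_all add: assms W kd)
  have "eval_at (vanishing S x) y \<subseteq> core (eval_at S x)"
    using vanishing_range[OF op assms(1) deep_scalars] by (auto simp: eval_at_def)
  then obtain w where w: "core (eval_at S x) \<subseteq> VF.span (insert w (eval_at (vanishing S x) y))"
    using span_insert_codim1[OF eval_at_subspace[OF Sx]] assms(3,5) by metis
  let ?A = "VF.span (insert w (eval_at S y))"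
  have "eval_at (vanishing S x) y \<subseteq> eval_at S y"
    by (intro eval_at_mono) (auto simp: vanishing_def)
  hence "core (eval_at S x) \<subseteq> ?A"
    using w VF.span_mono[of "insert w (eval_at (vanishing S x) y)" "insert w (eval_at S y)"] by blast
  moreover have "core (eval_at S y) \<subseteq> ?A"
    using core_subset[of "eval_at S y"] VF.span_superset[of "insert w (eval_at S y)"] by blast
  ultimately have "W \<subseteq> ?A"
    unfolding eq using VF.span_add by blast
  hence "VF.dim W \<le> VF.dim (insert w (eval_at S y))"
    by (rule VF.dim_mono)
  also have "\<dots> \<le> rk S y + 1"
    by (simp add: VF.dim_insert)
  finally show ?thesis using W by simp
qed

text \<open>A vector \<open>z\<close> suitable for \<open>vanishing S x\<close> can be moved along
  \<open>x\<close> to a vector of maximal rank for \<open>S\<close>, because maps killing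
  \<open>x\<close> do not see this translation.\<close>

lemma exists_max_rank_on_line:
  assumes "max_rank S x"
  obtains y where "max_rank S y" "eval_at (vanishing S x) y = eval_at (vanishing S x) z"
proof -
  obtain s where "rk S x \<le> rk S (sU x (\<iota> s) + z)"
    using exists_rank_ge_on_line[OF deepD(1)[OF S] deep_scalars, of x z] by blast
  hence "max_rank S (sU x (\<iota> s) + z)"
    using assms unfolding max_rank_def by (meson le_trans)
  thus ?thesis
    using that eval_vanishing_line[OF deepD(1)[OF S]] by blast
qed

end

proposition dim_deep_le_low_rank:
  assumes "deep S W" "VF.dim W = k * d" "many_scalars (k * d)" "\<And>x. rk S x + 1 < k * d"
  shows "int (H.dim S) \<le> \<alpha> k d - int k + max (2 - int d) 0"
proof (cases "d = 1")
  case True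
  have k: "k > 0" using assms(4)[of 0] by (cases k) auto
  obtain x where x: "max_rank S x" by (rule exists_max_rank)
  obtain k' where k': "VF.dim (core (eval_at S x)) = k' * d" "k' < k"
    using dim_core[OF assms(1,2) k] by blast
  have "k' \<le> rk S x"
    using VF.dim_subset[OF core_subset[of "eval_at S x"]] k'(1) True by simp
  hence "k' + 2 \<le> k" using assms(4)[of x] True by simp
  then obtain m where m: "k = Suc (Suc m)" "k' \<le> m"
    by (metis add_2_eq_Suc' le_Suc_ex add.commute le_add1 add_Suc)
  have "\<alpha> k' d \<le> \<alpha> m d" using m d_pos by (intro \<alpha>_mono)
  moreover have "\<alpha> k d = \<alpha> m d + int m + int (Suc m)"
    unfolding m \<alpha>_Suc True by simp
  ultimately show ?thesis
    using dim_le_of_core[OF assms(1-3) k x k'] assms(4)[of x] m True by simp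
next
  case False
  hence d: "2 \<le> d" using d_pos by simp
  have "int (H.dim S) \<le> \<alpha> k d - int k"
    using assms
  proof (induction k arbitrary: S W)
    case 0
    from "0.prems"(4)[of 0] show ?case by simp
  next
    case (Suc m)
    have op: "operator_space S" using deepD(1)[OF Suc.prems(1)] .
    show ?case
    proof (rule ccontr)
      assume "\<not> ?case"
      hence N: "int (H.dim S) > \<alpha> m d + int (Suc m * d) - 1 - int (Suc m)"
        unfolding \<alpha>_Suc by simp
      note ctx = Suc.prems(1-3) zero_less_Suc[of m]
      \<comment> \<open>A smaller core would cost a further \<open>Suc l * d - 1\<close>, too much
        for \<open>d \<ge> 2\<close>. Naming the products \<open>P\<close> and \<open>Q\<close>
        leaves linear arithmetic.\<close>
      have core: "VF.dim (core (eval_at S x)) = m * d" if x: "max_rank S x" for x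
      proof (rule ccontr)
        assume neq: "VF.dim (core (eval_at S x)) \<noteq> m * d"
        obtain k' where k': "VF.dim (core (eval_at S x)) = k' * d" "k' < Suc m"
          using dim_core[OF ctx(1,2,4)] by blast
        with neq have "k' < m" by (metis less_SucE)
        then obtain l where l: "m = Suc l" "k' \<le> l" by (cases m) auto
        have "\<alpha> k' d \<le> \<alpha> l d" using l d_pos by (intro \<alpha>_mono)
        moreover have "\<alpha> m d = \<alpha> l d + int (Suc l * d) - 1" unfolding l \<alpha>_Suc ..
        moreover have "2 * l + 2 \<le> Suc l * d" using mult_le_mono2[OF d, of "Suc l"] by simp
        moreover define P Q where "P = Suc m * d" and "Q = Suc l * d"
        ultimately show False
          using dim_le_of_core[OF ctx x k'] N Suc.prems(4)[of x] l(1)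
          unfolding P_def[symmetric] Q_def[symmetric] by simp
      qed
      obtain x where x: "max_rank S x" by (rule exists_max_rank)
      note v = deep_vanishing[OF Suc.prems(1) x deep_scalars[OF ctx]]
      have scal: "many_scalars (m * d)" using many_scalars_less[OF ctx] by blast
      \<comment> \<open>As the rank is at most \<open>Suc m * d - 2\<close>, an excess over the
        bound for \<open>Suc m\<close> passes to \<open>vanishing S x\<close> as an excess over the
        bound for \<open>m\<close>; so by induction \<open>vanishing S x\<close> has a vector of
        rank at least \<open>m * d - 1\<close>.\<close>
      have "int (H.dim (vanishing S x)) > \<alpha> m d - int m"
        using deep_dim[OF ctx, of x] N Suc.prems(4)[of x] by linarith
      moreover have "int (H.dim (vanishing S x)) \<le> \<alpha> m d"
        using dim_deep_le[OF v core[OF x] scal] by blast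
      ultimately have m: "m > 0" and "\<not> (\<forall>y. rk (vanishing S x) y + 1 < m * d)"
        using Suc.IH[OF v core[OF x] scal] by force+
      then obtain z where z: "m * d \<le> rk (vanishing S x) z + 1"
        by (meson not_less)
      obtain y where y: "max_rank S y" "eval_at (vanishing S x) y = eval_at (vanishing S x) z"
        using exists_max_rank_on_line[OF ctx x] by metis
      have z': "m * d \<le> rk (vanishing S x) y + 1" using z y(2) by simp
      show False
      proof (cases "core (eval_at S x) = core (eval_at S y)")
        case True
        have "1 * d + (m - 1) * 2 \<le> 1 * d + (m - 1) * d" using d by simp
        also have "\<dots> = m * d" using m by (simp add: algebra_simps flip: add_mult_distrib)
        finally have "m + 1 \<le> m * d" using m d by simp
        thus False
          using dim_le_of_same_core[OF ctx x y(1) True core[OF x] lessI z'] N Suc.prems(4)[of x]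
          by simp
      next
        case False
        have "Suc m * d \<le> rk S y + 1"
          using rank_of_distinct_cores[OF ctx x False] core[OF x] core[OF y(1)] z' by simp
        thus False using Suc.prems(4)[of y] by simp
      qed
    qed
  qed
  thus ?thesis by simp
qed

end

section \<open>Reconstructing an alternator from two vectors\<close>

context division_ring_spaces
begin

abbreviation linear_form :: "('v \<Rightarrow> 'f) \<Rightarrow> bool"
  where "linear_form \<equiv> Vector_Spaces.linear (restrict_scalars \<iota> sV) (*)"

lemmas form_simps = VF.form_add VF.form_diff VF.form_minus VF.form_0

lemma form_rscale: "linear_form \<phi> \<Longrightarrow> \<phi> (v \<cdot> \<iota> c) = c * \<phi> v"
  using VF.form_scale[of \<phi> c v] by (simp add: VF_scale_eq)

lemma linear_form_lincomb:
  assumes "linear_form \<phi>" "linear_form \<psi>"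
  shows "linear_form (\<lambda>v. a * \<phi> v + b * \<psi> v)"
  by (rule VF.linear_formI)
    (simp_all only: form_simps[OF assms(1)] form_simps[OF assms(2)] VF.form_scale[OF assms(1)]
      VF.form_scale[OF assms(2)] algebra_simps)

lemma linear_form_scale: "linear_form \<phi> \<Longrightarrow> linear_form (\<lambda>v. a * \<phi> v)"
  using linear_form_lincomb[of \<phi> \<phi> a 0] by simp

end

text \<open>The assumptions are symmetric under exchange of \<open>(x, \<phi>)\<close> and
  \<open>(y, \<psi>)\<close>. Facts are proved for \<phi> only and transferred to \<psi> by
  interpreting the symmetric instance.\<close>

locale linked_pair = division_ring_spaces \<iota> sU sV BD BV
  for \<iota> :: "'f::field \<Rightarrow> 'd::division_ring"
    and sU :: "'u::ab_group_add \<Rightarrow> 'd \<Rightarrow> 'u"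
    and sV :: "'v::ab_group_add \<Rightarrow> 'd \<Rightarrow> 'v"
    and BD BV +
  fixes S :: "('u \<Rightarrow> 'v) set" and x y :: 'u and \<phi> \<psi> :: "'v \<Rightarrow> 'f"
  assumes op: "operator_space S"
    and max_x: "max_rank S x" and max_y: "max_rank S y"
    and scalars_x: "many_scalars (Suc (rk S x))" and scalars_y: "many_scalars (Suc (rk S y))"
    and form_\<phi>: "linear_form \<phi>" and form_\<psi>: "linear_form \<psi>"
    and ker_\<phi>: "\<phi> v = 0 \<longleftrightarrow> v \<in> eval_at S x" and ker_\<psi>: "\<psi> v = 0 \<longleftrightarrow> v \<in> eval_at S y"
    and inter: "v \<in> eval_at S x \<Longrightarrow> v \<in> eval_at S y \<Longrightarrow>
      \<exists>f\<in>vanishing S x. \<exists>g\<in>vanishing S y. v = f y + g x"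
    and not_subset_x: "\<not> eval_at S x \<subseteq> eval_at S y" and not_subset_y: "\<not> eval_at S y \<subseteq> eval_at S x"
begin

lemma linked_pair_sym: "linked_pair \<iota> sU sV BD BV S y x \<psi> \<phi>"
proof (intro linked_pair.intro linked_pair_axioms.intro division_ring_spaces_axioms)
  fix v assume "v \<in> eval_at S y" "v \<in> eval_at S x"
  from inter[OF this(2,1)] show "\<exists>f\<in>vanishing S y. \<exists>g\<in>vanishing S x. v = f x + g y"
    by (metis add.commute)
qed (fact op max_x max_y scalars_x scalars_y form_\<phi> form_\<psi> ker_\<phi> ker_\<psi> not_subset_x not_subset_y)+

lemma \<phi>_eval [simp]: "f \<in> S \<Longrightarrow> \<phi> (f x) = 0"
  and \<psi>_eval [simp]: "f \<in> S \<Longrightarrow> \<psi> (f y) = 0"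
  by (simp_all add: ker_\<phi> ker_\<psi> eval_atI)

lemmas \<phi>_simps = form_simps[OF form_\<phi>] form_rscale[OF form_\<phi>]
lemmas \<psi>_simps = form_simps[OF form_\<psi>] form_rscale[OF form_\<psi>]

lemma \<phi>_vanishing: "f \<in> vanishing S x \<Longrightarrow> \<phi> (f z) = 0"
  using vanishing_eval_in[OF op max_x scalars_x] by (simp add: ker_\<phi>)

lemma obtain_next:
  assumes "\<phi> v = 0" obtains g where "g \<in> S" "v = g x"
  using assms by (auto simp: ker_\<phi> elim: eval_atE)

lemma \<phi>_second_order: "f \<in> vanishing S x \<Longrightarrow> g \<in> S \<Longrightarrow> f z = g x \<Longrightarrow> \<phi> (g z) = 0"
  using second_order[OF op max_x scalars_x] by (simp add: ker_\<phi>)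

lemma \<phi>_third_order:
  "f \<in> vanishing S x \<Longrightarrow> g \<in> S \<Longrightarrow> f z = g x \<Longrightarrow> h \<in> S \<Longrightarrow> g z = h x \<Longrightarrow> \<phi> (h z) = 0"
  using third_order[OF op max_x scalars_x] by (simp add: ker_\<phi>)

text \<open>Write \<open>f x = f1 y + g1 x\<close> by \<open>inter\<close>. Then
  \<open>f - g1\<close> sends \<open>x\<close> to \<open>f1 y\<close>, so
  \<open>\<phi>_second_order\<close> applies at \<open>y\<close>, where \<open>g1\<close>
  vanishes.\<close>

lemma \<phi>_eq_0_of_\<psi>:
  assumes "f \<in> S" "\<psi> (f x) = 0"
  shows "\<phi> (f y) = 0"
proof -
  obtain f1 g1 where fg: "f1 \<in> vanishing S x" "g1 \<in> vanishing S y" "f x = f1 y + g1 x"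
    using inter[of "f x"] assms by (auto simp: ker_\<psi>)
  have "\<phi> ((f - g1) y) = 0"
    using fg assms(1) by (intro \<phi>_second_order[OF fg(1)] space_diff[OF op]) (auto simp: vanishing_def)
  moreover have "g1 y = 0" using fg(2) by (simp add: vanishing_def)
  ultimately show ?thesis by simp
qed

lemma obtain_dual:
  obtains f where "f \<in> S" "\<psi> (f x) = 1"
proof -
  obtain f where f: "f \<in> S" "\<psi> (f x) \<noteq> 0"
    using not_subset_x by (auto simp: ker_\<psi> eval_at_def)
  show ?thesis
    using that[of "scH (1 / \<psi> (f x)) f"] f space_scale[OF op f(1)] by (simp add: scH_apply \<psi>_simps)
qed

text \<open>By \<open>\<phi>_eq_0_of_\<psi>\<close>, the functional sending \<open>f\<close> to
  \<open>\<phi> (f y)\<close> vanishes wherever \<open>\<psi> (f x)\<close> does, so the two are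
  proportional; \<open>not_subset_y\<close> excludes the factor 0.\<close>

lemma exists_normalisation:
  obtains c where "c \<noteq> 0" "\<And>f. f \<in> S \<Longrightarrow> \<phi> (f y) = c * \<psi> (f x)"
proof -
  obtain f0 where f0: "f0 \<in> S" "\<psi> (f0 x) = 1" by (rule obtain_dual)
  have eq: "\<phi> (f y) = \<phi> (f0 y) * \<psi> (f x)" if "f \<in> S" for f
  proof -
    have "\<phi> ((f - scH (\<psi> (f x)) f0) y) = 0"
      using that f0 by (intro \<phi>_eq_0_of_\<psi> space_diff[OF op] space_scale[OF op])
        (simp_all add: scH_apply \<psi>_simps)
    thus ?thesis by (simp add: scH_apply \<phi>_simps mult.commute)
  qed
  obtain f where "f \<in> S" "\<phi> (f y) \<noteq> 0"
    using not_subset_y by (auto simp: ker_\<phi> eval_at_def)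
  with eq have "\<phi> (f0 y) \<noteq> 0" by auto
  with eq that show ?thesis by blast
qed

end

text \<open>For an alternator \<open>b\<close> with \<open>b x = \<phi>\<close> and
  \<open>b y = \<psi>\<close> this is the polarised identity
  \<open>b x (f y) + b y (f x) = 0\<close>. It fixes the relative scale of the two forms.\<close>

locale normalised_pair = linked_pair +
  assumes norm: "f \<in> S \<Longrightarrow> \<phi> (f y) + \<psi> (f x) = 0"
begin

lemma normalised_pair_sym: "normalised_pair \<iota> sU sV BD BV S y x \<psi> \<phi>"
proof -
  interpret sym: linked_pair \<iota> sU sV BD BV S y x \<psi> \<phi> by (rule linked_pair_sym)
  show ?thesis by unfold_locales (simp add: norm add.commute)
qed

text \<open>Polarising \<open>\<phi>_second_order\<close> at \<open>y + z\<close>.\<close>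

lemma \<phi>_\<psi>_swap:
  assumes "f1 \<in> vanishing S x" "f \<in> S" "f x = f1 y"
  shows "\<phi> (f z) = \<psi> (f1 z)"
proof -
  have f1: "f1 \<in> S" using assms(1) by (simp add: vanishing_def)
  obtain g where g: "g \<in> S" "f1 z = g x"
    using obtain_next[OF \<phi>_vanishing[OF assms(1)]] by blast
  have "\<phi> ((f + g) (y + z)) = 0"
    using g assms f1 by (intro \<phi>_second_order[OF assms(1)] space_add[OF op]) (simp_all add: operator_add[OF op])
  moreover have "\<phi> (f y) = 0"
    by (rule \<phi>_second_order[OF assms(1,2)]) (simp add: assms(3))
  moreover have "\<phi> (g z) = 0"
    by (rule \<phi>_second_order[OF assms(1) g])
  ultimately have "\<phi> (f z) + \<phi> (g y) = 0"
    using g(1) assms(2) by (simp add: operator_add[OF op] \<phi>_simps algebra_simps)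
  moreover have "\<phi> (g y) + \<psi> (f1 z) = 0"
    using norm[OF g(1)] g(2) by simp
  ultimately show ?thesis by (simp add: add_eq_0_iff)
qed

text \<open>The two prescriptions for \<open>b z\<close> agree on a vector that is both
  \<open>f x\<close> and \<open>g y\<close>. With \<open>f x = f1 y + g1 x\<close>, the swap lemma
  applies to \<open>f - g1\<close> and, with the roles exchanged, to \<open>g - f1\<close>.\<close>

lemma \<phi>_eq_\<psi>:
  assumes "f \<in> S" "g \<in> S" "f x = g y"
  shows "\<phi> (f z) = \<psi> (g z)"
proof -
  interpret sym: normalised_pair \<iota> sU sV BD BV S y x \<psi> \<phi> by (rule normalised_pair_sym)
  have "f x \<in> eval_at S x" "f x \<in> eval_at S y"
    using assms by (simp_all add: eval_atI, metis eval_atI)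
  then obtain f1 g1 where fg: "f1 \<in> vanishing S x" "g1 \<in> vanishing S y" "f x = f1 y + g1 x"
    using inter by blast
  note S = vanishingD(1)[OF fg(1)] vanishingD(1)[OF fg(2)]
  have "\<phi> ((f - g1) z) = \<psi> (f1 z)"
    using fg assms S by (intro \<phi>_\<psi>_swap space_diff[OF op]) auto
  moreover have "\<psi> ((g - f1) z) = \<phi> (g1 z)"
    using fg assms S by (intro sym.\<phi>_\<psi>_swap space_diff[OF op]) auto
  ultimately show ?thesis by (simp add: \<phi>_simps \<psi>_simps diff_eq_eq add.commute)
qed

text \<open>Every vector is the sum of one in \<open>S x\<close> and a multiple of
  \<open>ge y\<close>, and \<open>pr\<close> is the projection to the former. A linear section
  \<sigma> of evaluation at \<open>x\<close> turns the two prescribed equations into a formula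
  linear in both arguments; \<open>\<phi>_eq_\<psi>\<close> shows that it respects all of
  \<open>S y\<close>.\<close>

lemma exists_polar_form:
  obtains b where "\<And>z. linear_form (b z)" "\<And>v. Vector_Spaces.linear (restrict_scalars \<iota> sU) (*) (\<lambda>z. b z v)"
    "\<And>z f. f \<in> S \<Longrightarrow> b z (f x) = - \<phi> (f z)" "\<And>z f. f \<in> S \<Longrightarrow> b z (f y) = - \<psi> (f z)"
proof -
  interpret sym: normalised_pair \<iota> sU sV BD BV S y x \<psi> \<phi> by (rule normalised_pair_sym)
  have "H.subspace S" using op by (simp add: operator_space_def)
  from ev.linear_exists_right_inverse_on[OF linear_eval this, of x]
  obtain \<sigma> where \<sigma>: "range \<sigma> \<subseteq> S" "Vector_Spaces.linear (restrict_scalars \<iota> sV) scH \<sigma>"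
    "\<And>v. v \<in> eval_at S x \<Longrightarrow> \<sigma> v x = v"
    by (auto simp: eval_at_image)
  interpret \<sigma>: Vector_Spaces.linear "restrict_scalars \<iota> sV" scH \<sigma> by fact
  have \<sigma>S: "\<sigma> v \<in> S" for v using \<sigma>(1) by blast
  have \<sigma>_scale: "\<sigma> (v \<cdot> \<iota> c) = scH c (\<sigma> v)" for v c
    using \<sigma>.scale[of c v] by (simp add: VF_scale_eq)
  obtain ge where ge: "ge \<in> S" "\<phi> (ge y) = 1" by (rule sym.obtain_dual)
  define pr where "pr v = v - ge y \<cdot> \<iota> (\<phi> v)" for v
  define b where "b z v = - \<phi> (\<sigma> (pr v) z) - \<phi> v * \<psi> (ge z)" for z v
  have pr_add: "pr (v + w) = pr v + pr w" for v w
    by (simp add: pr_def \<phi>_simps \<iota>_add V.rscale_add)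
  have pr_scale: "pr (v \<cdot> \<iota> c) = pr v \<cdot> \<iota> c" for v c
    by (simp add: pr_def \<phi>_simps V_diff_rscale V.rscale_rscale mult.commute flip: \<iota>_mult)
  show ?thesis
  proof (rule that[of b])
    show "linear_form (b z)" for z
    proof (rule VF.linear_formI)
      show "b z (v + w) = b z v + b z w" for v w
        by (simp add: b_def pr_add \<sigma>.add \<phi>_simps algebra_simps)
      show "b z (restrict_scalars \<iota> sV c v) = c * b z v" for c v
        by (simp add: b_def VF_scale_eq pr_scale \<sigma>_scale scH_apply \<phi>_simps algebra_simps)
    qed
    show "Vector_Spaces.linear (restrict_scalars \<iota> sU) (*) (\<lambda>z. b z v)" for v
    proof (rule UF.linear_formI)
      show "b (z + w) v = b z v + b w v" for z w
        by (simp add: b_def operator_add[OF op \<sigma>S] operator_add[OF op ge(1)] \<phi>_simps \<psi>_simps algebra_simps)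
      show "b (restrict_scalars \<iota> sU c z) v = c * b z v" for c z
        by (simp add: b_def restrict_scalars_def operator_rscale[OF op \<sigma>S] operator_rscale[OF op ge(1)]
            \<phi>_simps \<psi>_simps algebra_simps)
    qed
    show "b z (f x) = - \<phi> (f z)" if f: "f \<in> S" for z f
    proof -
      have "pr (f x) = f x" using f by (simp add: pr_def)
      moreover have "\<sigma> (f x) x = f x" using f by (intro \<sigma>(3)) auto
      hence "\<sigma> (f x) - f \<in> vanishing S x"
        using f \<sigma>S space_diff[OF op] by (simp add: vanishing_def)
      from \<phi>_vanishing[OF this, of z] have "\<phi> (\<sigma> (f x) z) = \<phi> (f z)"
        by (simp add: \<phi>_simps)
      ultimately show ?thesis using f by (simp add: b_def)
    qed
    show "b z (g y) = - \<psi> (g z)" if g: "g \<in> S" for z g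
    proof -
      define g' where "g' = g - scH (\<phi> (g y)) ge"
      have g': "g' \<in> S" unfolding g'_def by (intro space_diff[OF op] space_scale[OF op] g ge)
      have pr: "pr (g y) = g' y" by (simp add: g'_def pr_def scH_apply)
      have "\<phi> (g' y) = 0" using ge by (simp add: g'_def scH_apply \<phi>_simps)
      hence "\<sigma> (g' y) x = g' y" by (intro \<sigma>(3)) (simp add: ker_\<phi>)
      hence "\<phi> (\<sigma> (g' y) z) = \<psi> (g' z)" by (intro \<phi>_eq_\<psi> \<sigma>S g')
      thus ?thesis by (simp add: b_def pr) (simp add: g'_def scH_apply \<psi>_simps)
    qed
  qed
qed

end

text \<open>So far \<open>b\<close> satisfies the alternator identity only in its form polarised
  against \<open>x\<close> and \<open>y\<close>. The facts below control the remaining defect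
  \<open>b z (h z)\<close>.\<close>

locale polar_pair = normalised_pair +
  fixes b
  assumes form_b: "linear_form (b z)"
    and linear_b: "Vector_Spaces.linear (restrict_scalars \<iota> sU) (*) (\<lambda>z. b z v)"
    and b_x: "f \<in> S \<Longrightarrow> b z (f x) = - \<phi> (f z)" and b_y: "f \<in> S \<Longrightarrow> b z (f y) = - \<psi> (f z)"
begin

lemma polar_pair_sym: "polar_pair \<iota> sU sV BD BV S y x \<psi> \<phi> b"
proof -
  interpret sym: normalised_pair \<iota> sU sV BD BV S y x \<psi> \<phi> by (rule normalised_pair_sym)
  show ?thesis
    by (intro polar_pair.intro polar_pair_axioms.intro sym.normalised_pair_axioms form_b linear_b b_x b_y)
qed

lemmas b_simps = form_simps[OF form_b] form_rscale[OF form_b] UF.form_add[OF linear_b]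
  UF.form_diff[OF linear_b] UF.form_scale[OF linear_b, unfolded restrict_scalars_def]

lemma eval_decomposition:
  obtains f g where "f \<in> S" "g \<in> S" "v = f x + g y"
proof -
  interpret sym: normalised_pair \<iota> sU sV BD BV S y x \<psi> \<phi> by (rule normalised_pair_sym)
  obtain ge where ge: "ge \<in> S" "\<phi> (ge y) = 1" by (rule sym.obtain_dual)
  have "\<phi> (v - scH (\<phi> v) ge y) = 0" using ge by (simp add: scH_apply \<phi>_simps)
  then obtain f where f: "f \<in> S" "v - scH (\<phi> v) ge y = f x"
    by (rule obtain_next)
  show ?thesis
    using that[of f "scH (\<phi> v) ge"] f ge space_scale[OF op] by (simp add: algebra_simps)
qed

lemma b_at_x: "b x = \<phi>" and b_at_y: "b y = \<psi>"
proof -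
  have "b x v = \<phi> v \<and> b y v = \<psi> v" for v
  proof -
    obtain f g where fg: "f \<in> S" "g \<in> S" "v = f x + g y" by (rule eval_decomposition)
    show ?thesis
      using fg norm[OF fg(1)] norm[OF fg(2)]
      by (simp add: b_simps \<phi>_simps \<psi>_simps b_x b_y neg_eq_iff_add_eq_0 add.commute)
  qed
  thus "b x = \<phi>" "b y = \<psi>" by auto
qed

text \<open>The cross terms cancel: those with \<open>z\<close> by \<open>b_x\<close> and
  \<open>b_y\<close>, the one between \<open>x\<close> and \<open>y\<close> by
  \<open>norm\<close>.\<close>

lemma b_translate:
  assumes "h \<in> S"
  shows "b (z + sU x (\<iota> s) + sU y (\<iota> t)) (h (z + sU x (\<iota> s) + sU y (\<iota> t))) = b z (h z)"
  using assms norm[OF assms]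
  by (simp add: operator_add[OF op] operator_rscale[OF op] b_simps b_at_x b_at_y b_x b_y
      algebra_simps add_eq_0_iff)

text \<open>Translating \<open>z\<close> by a combination of \<open>x\<close> and \<open>y\<close>
  makes the form at \<open>z\<close> zero without changing the defect.\<close>

lemma b_eq_0_of_span:
  assumes "\<And>v. b z v = \<alpha>' * \<phi> v + \<beta> * \<psi> v" "h \<in> S"
  shows "b z (h z) = 0"
proof -
  have "b (z + sU x (\<iota> (- \<alpha>')) + sU y (\<iota> (- \<beta>))) v = 0" for v
    using assms(1) by (simp add: b_simps b_at_x b_at_y)
  thus ?thesis using b_translate[OF assms(2), of z "- \<alpha>'" "- \<beta>"] by simp
qed

lemma b_vanishing_x:
  assumes "f \<in> vanishing S x"
  shows "b z (f z) = 0"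
proof -
  obtain g where g: "g \<in> S" "f z = g x"
    using obtain_next[OF \<phi>_vanishing[OF assms]] by blast
  thus ?thesis using \<phi>_second_order[OF assms g] by (simp add: b_x)
qed

text \<open>If \<open>f z = g x\<close>, then \<open>b z (g z) = 0\<close> by third order
  perturbation. The statement about \<open>h\<close> comes from polarising this at
  \<open>z + y\<close>, where \<open>f\<close> takes the value \<open>(g + h) x\<close>, and
  translating back.\<close>

lemma b_vanishing_next:
  assumes f: "f \<in> vanishing S x" and h: "h \<in> S" "h x = f y"
  shows "b z (h z) = 0"
proof -
  have *: "b z (g z) = 0" if g: "g \<in> S" "f z = g x" for g z
  proof -
    obtain k where k: "k \<in> S" "g z = k x"
      using obtain_next[OF \<phi>_second_order[OF f g]] by blast
    thus ?thesis using \<phi>_third_order[OF f g k] by (simp add: b_x)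
  qed
  obtain g where g: "g \<in> S" "f z = g x"
    using obtain_next[OF \<phi>_vanishing[OF f]] by blast
  have "b (z + y) ((g + h) (z + y)) = 0"
    using g h vanishingD(1)[OF f] by (intro * space_add[OF op]) (simp_all add: operator_add[OF op])
  hence "b z ((g + h) z) = 0"
    using b_translate[of "g + h" z 0 1] space_add[OF op g(1) h(1)] U.rscale_one
    using U.rscale_add[of x 0 0] by simp
  thus ?thesis using *[OF g] by (simp add: b_simps)
qed

text \<open>With \<open>h x = f y + g x\<close> from \<open>inter\<close>, the part
  \<open>h - g\<close> falls under \<open>b_vanishing_next\<close> and \<open>g\<close> under the
  symmetric form of \<open>b_vanishing_x\<close>.\<close>

lemma b_diagonal_eq_0:
  assumes "h \<in> S" "\<psi> (h x) = 0"
  shows "b z (h z) = 0"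
proof -
  interpret sym: polar_pair \<iota> sU sV BD BV S y x \<psi> \<phi> b by (rule polar_pair_sym)
  obtain f g where fg: "f \<in> vanishing S x" "g \<in> vanishing S y" "h x = f y + g x"
    using inter[of "h x"] assms by (auto simp: ker_\<psi>)
  have "b z ((h - g) z) = 0"
    using fg assms(1) vanishingD(1)[OF fg(2)]
    by (intro b_vanishing_next[OF fg(1)] space_diff[OF op]) auto
  thus ?thesis using sym.b_vanishing_x[OF fg(2), of z] by (simp add: b_simps)
qed

lemma b_diagonal:
  obtains \<kappa> where "\<And>h. h \<in> S \<Longrightarrow> b z (h z) = \<kappa> * \<psi> (h x)"
proof -
  obtain f0 where f0: "f0 \<in> S" "\<psi> (f0 x) = 1" by (rule obtain_dual)
  have "b z (h z) = b z (f0 z) * \<psi> (h x)" if h: "h \<in> S" for h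
  proof -
    have "b z ((h - scH (\<psi> (h x)) f0) z) = 0"
      using h f0 by (intro b_diagonal_eq_0 space_diff[OF op] space_scale[OF op])
        (simp_all add: scH_apply \<psi>_simps)
    thus ?thesis by (simp add: scH_apply b_simps mult.commute)
  qed
  thus ?thesis by (rule that)
qed

text \<open>If the defect were nonzero, \<open>b z\<close> would be independent of \<phi> and
  \<psi>, and by dimension the common kernel of \<phi> and \<open>b z\<close> would be
  \<open>vanishing S x\<close> evaluated at \<open>z\<close>. A nonzero form \<chi> vanishing on
  \<open>S z\<close> is then a combination of \<phi> and \<open>b z\<close>, and evaluating it at
  \<open>g z\<close> forces both coefficients to be 0.\<close>

lemma b_eq_0_of_large_rank:
  assumes "VF.dim UNIV \<le> rk (vanishing S x) z + 2" "eval_at S z \<noteq> UNIV" "h \<in> S"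
  shows "b z (h z) = 0"
proof (rule ccontr)
  assume nz: "b z (h z) \<noteq> 0"
  obtain \<kappa> where \<kappa>: "\<And>h. h \<in> S \<Longrightarrow> b z (h z) = \<kappa> * \<psi> (h x)" using b_diagonal[of z] by blast
  have indep: False if "\<And>v. b z v = \<alpha>' * \<phi> v + \<beta> * \<psi> v" for \<alpha>' \<beta>
    using b_eq_0_of_span[OF that assms(3)] nz by blast
  let ?K = "{v. \<phi> v = 0 \<and> b z v = 0}" and ?H = "eval_at (vanishing S x) z"
  have subK: "VF.subspace ?K"
    by (rule VF.subspaceI) (simp_all add: VF_scale_eq \<phi>_simps b_simps)
  have subH: "VF.subspace ?H"
    by (intro eval_at_subspace operator_space_vanishing op)
  have HK: "?H \<subseteq> ?K"
    using \<phi>_vanishing b_vanishing_x by (auto simp: eval_at_def)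
  have subx: "VF.subspace (eval_at S x)" by (rule eval_at_subspace[OF op])
  have "?K \<subseteq> eval_at S x" by (auto simp: ker_\<phi>)
  moreover have "?K \<noteq> eval_at S x"
  proof
    assume "?K = eval_at S x"
    hence "\<And>v. \<phi> v = 0 \<Longrightarrow> b z v = 0" by (auto simp: ker_\<phi>)
    then obtain a where "\<And>v. b z v = a * \<phi> v"
      using VF.linear_form_multiple[OF form_b form_\<phi>] by blast
    thus False using indep[of a 0] by simp
  qed
  ultimately have "VF.dim ?K < rk S x"
    using VF.dim_psubset[of ?K "eval_at S x"] subK subx by (simp add: VF.span_eq_iff[THEN iffD2] psubset_eq)
  moreover have "eval_at S x \<noteq> UNIV"
    using not_subset_y by auto
  hence "rk S x < VF.dim UNIV"
    using VF.dim_psubset[of "eval_at S x" UNIV] subx by (simp add: VF.span_eq_iff[THEN iffD2] psubset_eq)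
  ultimately have K: "?K = ?H"
    using HK subK subH assms(1) by (intro VF.subspace_dim_equal[symmetric]) auto
  have subz: "VF.subspace (eval_at S z)" by (rule eval_at_subspace[OF op])
  obtain u where "u \<notin> eval_at S z" using assms(2) by blast
  then obtain \<chi> where \<chi>: "linear_form \<chi>" "\<chi> u = 1" "\<And>v. v \<in> eval_at S z \<Longrightarrow> \<chi> v = 0"
    using VF.exists_linear_form[OF subz] by metis
  have "\<chi> v = 0" if "\<phi> v = 0" "b z v = 0" for v
  proof -
    have "v \<in> ?H" using that K by blast
    thus ?thesis using \<chi>(3) by (auto simp: eval_at_def vanishing_def)
  qed
  then obtain \<alpha>' \<beta> where ab: "\<And>v. \<chi> v = \<alpha>' * \<phi> v + \<beta> * b z v"
    using VF.linear_form_combination[OF \<chi>(1) form_\<phi> form_b] by blast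
  \<comment> \<open>For \<open>v = g x\<close>, the relation \<open>\<chi> (g z) = 0\<close> becomes
    one between forms in \<open>v\<close>, since \<open>\<phi> (g z) = - b z v\<close> and
    \<open>b z (g z) = \<kappa> * \<psi> v\<close>.\<close>
  have eq: "(\<beta> * \<kappa>) * \<psi> v + (- \<alpha>') * b z v = 0" if v: "\<phi> v = 0" for v
  proof -
    obtain g where g: "g \<in> S" "v = g x" by (rule obtain_next[OF v])
    have "\<alpha>' * \<phi> (g z) + \<beta> * b z (g z) = 0"
      using ab \<chi>(3) g(1) by (metis eval_atI)
    thus ?thesis using \<kappa>[OF g(1)] b_x[OF g(1), of z] g(2) by (simp add: algebra_simps)
  qed
  have lin: "linear_form (\<lambda>v. (\<beta> * \<kappa>) * \<psi> v + (- \<alpha>') * b z v)"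
    by (rule linear_form_lincomb[OF form_\<psi> form_b])
  then obtain c where c: "\<And>v. (\<beta> * \<kappa>) * \<psi> v + (- \<alpha>') * b z v = c * \<phi> v"
    using VF.linear_form_multiple[OF lin form_\<phi>] eq by blast
  have "\<alpha>' = 0"
  proof (rule ccontr)
    assume "\<alpha>' \<noteq> 0"
    hence "b z v = (- c / \<alpha>') * \<phi> v + (\<beta> * \<kappa> / \<alpha>') * \<psi> v" for v
      using c[of v] by (simp add: field_simps)
    thus False by (rule indep)
  qed
  moreover have "\<kappa> \<noteq> 0" using nz \<kappa>[OF assms(3)] by auto
  moreover obtain f0 where f0: "f0 \<in> S" "\<psi> (f0 x) = 1" by (rule obtain_dual)
  ultimately have "\<beta> = 0" using c[of "f0 x"] by simp
  with \<open>\<alpha>' = 0\<close> show False using ab[of u] \<chi>(2) by simp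
qed

end

text \<open>Both \<open>b z\<close> and \<open>b' z\<close> are prescribed on \<open>S y\<close> by
  the same \<psi>, so they differ by \<open>l * \<psi>\<close>. Evaluating the difference at
  \<open>g z\<close> shows that \<open>\<kappa> * \<phi> - \<kappa>' * \<phi>' + l * b z\<close>
  vanishes on \<open>S y\<close> and is a multiple of \<psi>. Independence gives
  \<open>l \<noteq> 0\<close>, which allows solving for \<open>b z\<close>.\<close>

lemma (in division_ring_spaces) polar_forms_compare:
  assumes "polar_pair \<iota> sU sV BD BV S x y \<phi> \<psi> b" "polar_pair \<iota> sU sV BD BV S x' y \<phi>' \<psi> b'"
    and "\<And>c c'. \<not> (\<forall>v. \<phi> v = c * \<phi>' v + c' * \<psi> v)" and "h \<in> S" "b z (h z) \<noteq> 0"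
  shows "\<exists>c1 c2 c3. \<forall>v. b z v = c1 * \<phi> v + c2 * \<psi> v + c3 * \<phi>' v"
proof -
  interpret P: polar_pair \<iota> sU sV BD BV S x y \<phi> \<psi> b by fact
  interpret Q: polar_pair \<iota> sU sV BD BV S x' y \<phi>' \<psi> b' by fact
  obtain \<kappa> where \<kappa>: "\<And>h. h \<in> S \<Longrightarrow> b z (h z) = \<kappa> * \<psi> (h x)" using P.b_diagonal[of z] by blast
  obtain \<kappa>' where \<kappa>': "\<And>h. h \<in> S \<Longrightarrow> b' z (h z) = \<kappa>' * \<psi> (h x')" using Q.b_diagonal[of z] by blast
  have "\<kappa> \<noteq> 0" using assms(4,5) \<kappa> by auto
  have sub: "linear_form (\<lambda>v. 1 * b' z v + (- 1) * b z v)"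
    by (rule linear_form_lincomb[OF Q.form_b P.form_b])
  have "1 * b' z v + (- 1) * b z v = 0" if "\<psi> v = 0" for v
  proof -
    obtain g where g: "g \<in> S" "v = g y" using \<open>\<psi> v = 0\<close> by (auto simp: P.ker_\<psi> elim: eval_atE)
    thus ?thesis by (simp add: P.b_y Q.b_y)
  qed
  then obtain l where l: "\<And>v. 1 * b' z v + (- 1) * b z v = l * \<psi> v"
    using VF.linear_form_multiple[OF sub P.form_\<psi>] by blast
  have form: "linear_form (\<lambda>v. 1 * (\<kappa> * \<phi> v + (- \<kappa>') * \<phi>' v) + l * b z v)"
    by (rule linear_form_lincomb[OF linear_form_lincomb[OF P.form_\<phi> Q.form_\<phi>] P.form_b])
  have "1 * (\<kappa> * \<phi> v + (- \<kappa>') * \<phi>' v) + l * b z v = 0" if "\<psi> v = 0" for v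
  proof -
    obtain g where g: "g \<in> S" "v = g y" using \<open>\<psi> v = 0\<close> by (auto simp: P.ker_\<psi> elim: eval_atE)
    have "\<psi> (g x) = - \<phi> (g y)" "\<psi> (g x') = - \<phi>' (g y)"
      using P.norm[OF g(1)] Q.norm[OF g(1)] by (simp_all add: add_eq_0_iff)
    thus ?thesis
      using l[of "g z"] \<kappa>[OF g(1)] \<kappa>'[OF g(1)] P.b_y[OF g(1), of z] g(2) by simp
  qed
  then obtain m where m: "\<And>v. 1 * (\<kappa> * \<phi> v + (- \<kappa>') * \<phi>' v) + l * b z v = m * \<psi> v"
    using VF.linear_form_multiple[OF form P.form_\<psi>] by blast
  have "l \<noteq> 0"
  proof
    assume "l = 0"
    hence "\<phi> v = (\<kappa>' / \<kappa>) * \<phi>' v + (m / \<kappa>) * \<psi> v" for v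
      using m[of v] \<open>\<kappa> \<noteq> 0\<close> by (simp add: field_simps)
    thus False using assms(3) by blast
  qed
  have "b z v = (- \<kappa> / l) * \<phi> v + (m / l) * \<psi> v + (\<kappa>' / l) * \<phi>' v" for v
    using m[of v] \<open>l \<noteq> 0\<close> by (simp add: field_simps)
  thus ?thesis by blast
qed

section \<open>Existence and uniqueness of the alternator\<close>

text \<open>When a space is split by a subspace, the mixed term is the amount by which the bounds
  for the two pieces fall short of the bound for the whole.\<close>

lemma \<alpha>_add: "\<alpha> (k + j) d = \<alpha> k d + \<alpha> j d + int (d * k * j)"
proof (induction j)
  case (Suc j)
  have "\<alpha> (k + Suc j) d = \<alpha> (k + j) d + int (Suc (k + j) * d) - 1"
    using \<alpha>_Suc[of "k + j" d] by simp
  thus ?case using Suc by (simp add: \<alpha>_Suc algebra_simps)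
qed simp

context division_ring_spaces
begin

definition alternator :: "('u \<Rightarrow> 'v) set \<Rightarrow> ('u \<Rightarrow> 'v \<Rightarrow> 'f) \<Rightarrow> bool"
  where "alternator S b \<longleftrightarrow> b \<in> Alt (restrict_scalars \<iota> sU) (restrict_scalars \<iota> sV) S"

lemma alternatorD:
  assumes "alternator S b"
  shows "linear_form (b z)" "Vector_Spaces.linear (restrict_scalars \<iota> sU) (*) (\<lambda>z. b z v)"
    "f \<in> S \<Longrightarrow> b z (f z) = 0"
  using assms by (auto simp: alternator_def Alt_def)

lemma alternatorI:
  assumes "\<And>z. linear_form (b z)" "\<And>v. Vector_Spaces.linear (restrict_scalars \<iota> sU) (*) (\<lambda>z. b z v)"
    "\<And>z f. f \<in> S \<Longrightarrow> b z (f z) = 0"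
  shows "alternator S b"
  using assms by (auto simp: alternator_def Alt_def)

lemma alternator_polar:
  assumes "alternator S b" "operator_space S" "f \<in> S"
  shows "b z (f w) = - b w (f z)"
proof -
  have "b (z + w) (f (z + w)) = 0" using alternatorD(3)[OF assms(1,3)] .
  thus ?thesis using alternatorD(3)[OF assms(1,3)]
    by (simp add: operator_add[OF assms(2,3)] form_simps[OF alternatorD(1)[OF assms(1)]]
        UF.form_add[OF alternatorD(2)[OF assms(1)]] eq_neg_iff_add_eq_0 add.commute)
qed

end

text \<open>\<open>b1 x\<close> vanishes on \<open>S x\<close> and so is \<open>c * \<phi>\<close>.
  Polarisation then gives \<open>b1 z\<close> on \<open>S x\<close>, hence \<open>b1 y\<close>, and
  by polarisation again \<open>b1 z\<close> on \<open>S y\<close>.\<close>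

lemma (in polar_pair) alternator_unique:
  assumes alt: "alternator S b1"
  shows "\<exists>c. \<forall>z v. b1 z v = c * b z v"
proof -
  note form = form_simps[OF alternatorD(1)[OF alt]] and zero = alternatorD(3)[OF alt]
    and polar = alternator_polar[OF alt op]
  have "b1 x v = 0" if "\<phi> v = 0" for v
    using that zero by (auto elim: obtain_next)
  then obtain c where c: "\<And>v. b1 x v = c * \<phi> v"
    using VF.linear_form_multiple[OF alternatorD(1)[OF alt] form_\<phi>] by blast
  have 1: "b1 z (f x) = c * b z (f x)" if "f \<in> S" for f z
    using polar[OF that, of z x] that by (simp add: c b_x)
  have 2: "b1 y v = c * b y v" for v
  proof -
    obtain f g where fg: "f \<in> S" "g \<in> S" "v = f x + g y" by (rule eval_decomposition)
    thus ?thesis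
      using 1[OF fg(1)] zero[OF fg(2), of y] b_y[OF fg(2), of y]
      by (simp add: form b_simps algebra_simps)
  qed
  have "b1 z v = c * b z v" for z v
  proof -
    obtain f g where fg: "f \<in> S" "g \<in> S" "v = f x + g y" by (rule eval_decomposition)
    have "b1 z (g y) = c * b z (g y)"
      using polar[OF fg(2), of z y] fg(2) by (simp add: 2 b_at_y b_y)
    thus ?thesis
      using 1[OF fg(1)] fg(3) by (simp add: form b_simps algebra_simps)
  qed
  thus ?thesis by blast
qed

section \<open>Twisted forms and wide pairs\<close>

context division_ring_spaces
begin

lemma hyperplane_form:
  assumes "VF.subspace A" "VF.dim A + 1 = VF.dim UNIV"
  obtains \<phi> where "linear_form \<phi>" "\<And>v. \<phi> v = 0 \<longleftrightarrow> v \<in> A"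
proof -
  have "A \<noteq> UNIV" using assms(2) by auto
  then obtain u where "u \<notin> A" by blast
  then obtain \<phi> where \<phi>: "linear_form \<phi>" "\<phi> u = 1" "\<And>a. a \<in> A \<Longrightarrow> \<phi> a = 0"
    using VF.exists_linear_form[OF assms(1)] by metis
  let ?K = "{v. \<phi> v = 0}"
  have K: "VF.subspace ?K"
    by (rule VF.subspaceI) (simp_all add: form_simps[OF \<phi>(1)] VF.form_scale[OF \<phi>(1)])
  have "?K \<noteq> UNIV" using \<phi>(2) by (metis UNIV_I mem_Collect_eq zero_neq_one)
  hence "VF.dim ?K < VF.dim UNIV"
    using VF.dim_psubset[of ?K UNIV] K by (simp add: VF.span_eq_iff[THEN iffD2] psubset_eq)
  hence "A = ?K"
    using \<phi>(3) assms K by (intro VF.subspace_dim_equal) auto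
  thus ?thesis using that[OF \<phi>(1)] by blast
qed

lemma dim_image_rscale:
  assumes "a \<noteq> 0"
  shows "VF.dim ((\<lambda>v. v \<cdot> a) ` A) = VF.dim A"
proof -
  interpret VV: finite_dimensional_vector_space_pair_1 "restrict_scalars \<iota> sV" BV "restrict_scalars \<iota> sV" ..
  have "Vector_Spaces.linear (restrict_scalars \<iota> sV) (restrict_scalars \<iota> sV) (\<lambda>v. v \<cdot> a)"
    unfolding Vector_Spaces.linear_iff using VF.vector_space_axioms
    by (simp add: VF_scale_eq V.add_rscale V.rscale_rscale \<iota>_central)
  moreover have "inj_on (\<lambda>v. v \<cdot> a) (VF.span A)"
    by (rule inj_on_inverseI[where g = "\<lambda>v. v \<cdot> inverse a"]) (simp add: assms)
  ultimately show ?thesis by (rule VV.dim_image_eq)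
qed

text \<open>The combination is \<open>\<phi> (v \<cdot> t)\<close> for the single scalar
  \<open>t = \<iota> \<alpha>' + inverse a * \<iota> \<beta>\<close>. As \<phi> is nonzero,
  \<open>t\<close> must be 0, and for \<open>\<beta> \<noteq> 0\<close> this would put
  \<open>a\<close> in the central subfield.\<close>

lemma twisted_form_independent:
  assumes "a \<notin> range \<iota>" "linear_form \<phi>" "\<phi> u \<noteq> 0"
    and "\<And>v. \<alpha>' * \<phi> v + \<beta> * \<phi> (v \<cdot> inverse a) = 0"
  shows "\<alpha>' = 0 \<and> \<beta> = 0"
proof -
  define t where "t = \<iota> \<alpha>' + inverse a * \<iota> \<beta>"
  have "\<phi> (v \<cdot> t) = 0" for v
  proof -
    have "\<phi> (v \<cdot> t) = \<alpha>' * \<phi> v + \<beta> * \<phi> (v \<cdot> inverse a)"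
      by (simp add: t_def V.rscale_add form_simps[OF assms(2)] form_rscale[OF assms(2)]
          flip: V.rscale_rscale)
    thus ?thesis using assms(4) by simp
  qed
  from this[of "u \<cdot> inverse t"] have t: "t = 0" using assms(3) by (cases "t = 0") auto
  have "\<beta> = 0"
  proof (rule ccontr)
    assume "\<beta> \<noteq> 0"
    have "a \<noteq> 0" using assms(1) \<iota>_simps(2) by (metis rangeI)
    have "a * t = a * \<iota> \<alpha>' + \<iota> \<beta>" using \<open>a \<noteq> 0\<close>
      by (simp add: t_def distrib_left flip: mult.assoc)
    hence eq: "a * \<iota> \<alpha>' = - \<iota> \<beta>" using t by (simp add: eq_neg_iff_add_eq_0)
    have "\<alpha>' \<noteq> 0" using eq \<open>\<beta> \<noteq> 0\<close> by auto
    hence "\<iota> \<alpha>' * \<iota> (1 / \<alpha>') = 1" by (simp flip: \<iota>_mult)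
    hence "a = a * \<iota> \<alpha>' * \<iota> (1 / \<alpha>')" by (simp add: mult.assoc)
    also have "\<dots> = \<iota> (- \<beta> * (1 / \<alpha>'))" unfolding eq by (simp only: \<iota>_mult \<iota>_minus)
    finally show False using assms(1) by blast
  qed
  thus ?thesis using t by (simp add: t_def)
qed

text \<open>The pairs of vectors from which an alternator can be reconstructed.\<close>

definition wide_pair :: "('u \<Rightarrow> 'v) set \<Rightarrow> nat \<Rightarrow> 'u \<Rightarrow> 'u \<Rightarrow> bool"
  where "wide_pair S m x y \<longleftrightarrow> max_rank S x \<and> max_rank S y \<and>
    rk S x + 1 = VF.dim UNIV \<and> rk S y + 1 = VF.dim UNIV \<and>
    VF.dim (core (eval_at S x)) = m * d \<and> VF.dim (core (eval_at S y)) = m * d \<and>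
    core (eval_at S x) \<noteq> core (eval_at S y) \<and>
    rk (vanishing S x) y + 1 = m * d \<and> rk (vanishing S y) x + 1 = m * d"

lemma wide_pair_sym: "wide_pair S m x y \<Longrightarrow> wide_pair S m y x"
  by (auto simp: wide_pair_def)

context
  fixes S m
  assumes S: "deep S UNIV" and dimV: "VF.dim UNIV = Suc m * d" and scalars: "many_scalars (Suc m * d)"
begin

lemma operator_space_S: "operator_space S"
  using deepD(1)[OF S] .

lemmas ctx = S dimV scalars zero_less_Suc

lemma eval_at_neq_UNIV: "eval_at S x \<noteq> UNIV"
  using deep_rank_bound[OF ctx, of x] dimV by auto

lemma exists_wide_pair:
  assumes "int (H.dim S) \<ge> \<alpha> (Suc m) d - int (Suc m) + max (4 - int d) 2"
  obtains x y where "wide_pair S m x y"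
proof -
  have N: "\<alpha> m d + int (Suc m * d) - 1 - int (Suc m) + max (4 - int d) 2 \<le> int (H.dim S)"
    using assms unfolding \<alpha>_Suc by simp
  have "int (H.dim S) \<le> \<alpha> m d + int (Suc m * d) - 1"
    using dim_deep_le[OF S dimV scalars] unfolding \<alpha>_Suc by simp
  \<comment> \<open>The lower bound can hold together with the general upper bound only in dimension
    at least 2.\<close>
  hence "int (Suc m) \<ge> max (4 - int d) 2" using N by linarith
  hence m: "m \<ge> 1" by simp
  have ex: "\<exists>x. Suc m * d \<le> rk S x + 1"
  proof (rule ccontr)
    assume "\<not> ?thesis"
    hence "\<And>x. rk S x + 1 < Suc m * d" by (meson not_less)
    from dim_deep_le_low_rank[OF S dimV scalars this] assms show False by simp
  qed
  have rank: "rk S x + 1 = Suc m * d" if "max_rank S x" for x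
  proof -
    obtain y where "Suc m * d \<le> rk S y + 1" using ex by blast
    moreover have "rk S y \<le> rk S x" using that by (simp add: max_rank_def)
    ultimately show ?thesis using deep_rank_bound[OF ctx, of x] by simp
  qed
  have core: "VF.dim (core (eval_at S x)) = m * d" if x: "max_rank S x" for x
  proof (rule ccontr)
    assume neq: "VF.dim (core (eval_at S x)) \<noteq> m * d"
    obtain k' where k': "VF.dim (core (eval_at S x)) = k' * d" "k' < Suc m"
      using dim_core[OF S dimV] by blast
    with neq have "k' < m" by (metis less_SucE)
    then obtain l where l: "m = Suc l" "k' \<le> l" by (cases m) auto
    have "\<alpha> k' d \<le> \<alpha> l d" using l d_pos by (intro \<alpha>_mono)
    moreover have "\<alpha> m d = \<alpha> l d + int (Suc l * d) - 1" unfolding l \<alpha>_Suc ..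
    moreover have "l + 3 < Suc l * d + nat (max (4 - int d) 2)"
    proof (cases "d = 1")
      case False
      hence "2 * l + 2 \<le> Suc l * d" using mult_le_mono2[of 2 d "Suc l"] d_pos by simp
      moreover have "nat (max (4 - int d) 2) \<ge> 2" by simp
      ultimately show ?thesis by linarith
    qed simp
    moreover define P Q where "P = Suc m * d" and "Q = Suc l * d"
    ultimately show False
      using dim_le_of_core[OF ctx x k'] N rank[OF x] l(1)
      unfolding P_def[symmetric] Q_def[symmetric] by simp
  qed
  obtain x where x: "max_rank S x" by (rule exists_max_rank)
  note v = deep_vanishing[OF S x deep_scalars[OF ctx]]
  have scal: "many_scalars (m * d)" using many_scalars_less[OF ctx] by blast
  have "\<exists>z. m * d \<le> rk (vanishing S x) z + 1"
  proof (rule ccontr)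
    assume "\<not> ?thesis"
    hence "\<And>z. rk (vanishing S x) z + 1 < m * d" by (meson not_less)
    note dim_deep_le_low_rank[OF v core[OF x] scal this]
    \<comment> \<open>The constant in (c) exceeds the one in (b) by 2. One unit is lost in passing
      from \<open>Suc m\<close> to \<open>m\<close>; the other still contradicts (b) for
      \<open>vanishing S x\<close>.\<close>
    moreover have "max (2 - int d) 0 < max (4 - int d) 2 - 1" by (simp add: max_def)
    moreover define P where "P = Suc m * d"
    ultimately show False
      using deep_dim[OF ctx, of x] N rank[OF x] unfolding P_def[symmetric] by linarith
  qed
  then obtain z where z: "m * d \<le> rk (vanishing S x) z + 1" by blast
  obtain y where y: "max_rank S y" "eval_at (vanishing S x) y = eval_at (vanishing S x) z"
    using exists_max_rank_on_line[OF ctx x] by metis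
  have "rk (vanishing S x) y < m * d"
    using deep_rank_less[OF v] core[OF x] m d_pos by simp
  hence xy: "rk (vanishing S x) y + 1 = m * d" using z y(2) by simp
  have neq: "core (eval_at S x) \<noteq> core (eval_at S y)"
  proof
    assume eq: "core (eval_at S x) = core (eval_at S y)"
    have "m + 2 < m * d + nat (max (4 - int d) 2)"
    proof (cases "d = 1")
      case False
      hence "2 * m \<le> m * d" using mult_le_mono2[of 2 d m] d_pos by simp
      moreover have "nat (max (4 - int d) 2) \<ge> 2" by simp
      ultimately show ?thesis using m by linarith
    qed simp
    hence "int m + 2 < int (m * d) + max (4 - int d) 2" by linarith
    moreover have "int (H.dim S) \<le> int (rk S x) + \<alpha> m d - (int (m * d) - 1)"
      using dim_le_of_same_core[OF ctx x y(1) eq core[OF x]] xy by simp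
    moreover define P Q where "P = Suc m * d" and "Q = m * d"
    ultimately show False
      using N rank[OF x] unfolding P_def[symmetric] Q_def[symmetric] by linarith
  qed
  obtain B where B: "finite B" "S \<subseteq> H.span B"
    using dim_deep_le[OF S dimV scalars] by blast
  have sub: "vanishing S w \<subseteq> H.span B" for w using B(2) by (auto simp: vanishing_def)
  \<comment> \<open>The maps killing both vectors are counted in two orders, which transfers the
    rank from \<open>(x, y)\<close> to \<open>(y, x)\<close>.\<close>
  have "vanishing (vanishing S x) y = vanishing (vanishing S y) x" by (auto simp: vanishing_def)
  hence "rk (vanishing S y) x = rk (vanishing S x) y"
    using rank_le_dim[OF operator_space_vanishing[OF operator_space_S] B(1) sub[of x], of y]
      rank_le_dim[OF operator_space_vanishing[OF operator_space_S] B(1) sub[of y], of x]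
      deep_dim[OF ctx, of x] deep_dim[OF ctx, of y] rank[OF x] rank[OF y(1)] by simp
  hence "wide_pair S m x y"
    unfolding wide_pair_def using x y(1) rank[OF x] rank[OF y(1)] core[OF x] core[OF y(1)] neq xy dimV
    by simp
  thus ?thesis by (rule that)
qed

context
  fixes x y assumes wide: "wide_pair S m x y"
begin

lemma wideD: "max_rank S x" "max_rank S y" "rk S x + 1 = Suc m * d" "rk S y + 1 = Suc m * d"
    "VF.dim (core (eval_at S x)) = m * d" "VF.dim (core (eval_at S y)) = m * d"
    "core (eval_at S x) \<noteq> core (eval_at S y)"
    "rk (vanishing S x) y + 1 = m * d" "rk (vanishing S y) x + 1 = m * d"
  using wide by (simp_all add: wide_pair_def dimV)

lemma wide_cores_sum: "\<exists>u v. w = u + v \<and> u \<in> core (eval_at S x) \<and> v \<in> core (eval_at S y)"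
proof -
  have "UNIV = {u + v |u v. u \<in> core (eval_at S x) \<and> v \<in> core (eval_at S y)}"
    by (rule hyperplanes_sum[OF V_subspace_UNIV V_subspace_core_eval[OF ctx]
        V_subspace_core_eval[OF ctx] _ _ wideD(7)]) (simp_all add: wideD dimV)
  thus ?thesis by blast
qed

lemma wide_not_subset: "\<not> eval_at S x \<subseteq> eval_at S y"
proof
  assume "eval_at S x \<subseteq> eval_at S y"
  hence "eval_at S x = eval_at S y"
    using wideD(3,4) by (intro VF.subspace_dim_equal eval_at_subspace operator_space_S) auto
  thus False using wideD(7) by simp
qed

text \<open>The two cores span everything, and each exceeds its summand of \<open>?P\<close> by at
  most one vector, so \<open>?P\<close> has codimension at most 2. It lies in the intersection of
  \<open>S x\<close> and \<open>S y\<close>, which is properly contained in a hyperplane.\<close>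

lemma wide_inter:
  assumes "v \<in> eval_at S x" "v \<in> eval_at S y"
  shows "\<exists>f\<in>vanishing S x. \<exists>g\<in>vanishing S y. v = f y + g x"
proof -
  let ?X = "eval_at (vanishing S x) y" and ?Y = "eval_at (vanishing S y) x"
  let ?P = "{p + q |p q. p \<in> ?X \<and> q \<in> ?Y}"
  have X: "VF.subspace ?X" and Y: "VF.subspace ?Y"
    by (intro eval_at_subspace operator_space_vanishing operator_space_S)+
  have P: "VF.subspace ?P" by (rule VF.subspace_sums[OF X Y])
  have XP: "?X \<subseteq> ?P" using VF.subspace_0[OF Y] by force
  have YP: "?Y \<subseteq> ?P" using VF.subspace_0[OF X] by force
  have Xc: "?X \<subseteq> core (eval_at S x)"
    using vanishing_range[OF operator_space_S wideD(1) deep_scalars[OF ctx]] by (auto simp: eval_at_def)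
  have Yc: "?Y \<subseteq> core (eval_at S y)"
    using vanishing_range[OF operator_space_S wideD(2) deep_scalars[OF ctx]] by (auto simp: eval_at_def)
  have "VF.dim (core (eval_at S x)) \<le> VF.dim ?X + 1" using wideD(5,8) by simp
  then obtain w where w: "core (eval_at S x) \<subseteq> VF.span (insert w ?X)"
    by (rule span_insert_codim1[OF X Xc])
  have "VF.dim (core (eval_at S y)) \<le> VF.dim ?Y + 1" using wideD(6,9) by simp
  then obtain w' where w': "core (eval_at S y) \<subseteq> VF.span (insert w' ?Y)"
    by (rule span_insert_codim1[OF Y Yc])
  let ?A = "VF.span (insert w (insert w' ?P))"
  have "VF.span (insert w ?X) \<subseteq> ?A" "VF.span (insert w' ?Y) \<subseteq> ?A"
    using XP YP by (intro VF.span_mono; blast)+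
  hence A: "core (eval_at S x) \<subseteq> ?A" "core (eval_at S y) \<subseteq> ?A"
    using w w' by blast+
  have "v \<in> ?A" for v
  proof -
    obtain p q where "v = p + q" "p \<in> core (eval_at S x)" "q \<in> core (eval_at S y)"
      using wide_cores_sum[of v] by blast
    thus ?thesis using A by (auto intro: VF.span_add)
  qed
  hence "UNIV \<subseteq> ?A" by blast
  hence "VF.dim UNIV \<le> VF.dim (insert w (insert w' ?P))" by (rule VF.dim_mono)
  also have "\<dots> \<le> VF.dim ?P + 2"
    by (simp add: VF.dim_insert)
  finally have dimP: "Suc m * d \<le> VF.dim ?P + 2" unfolding dimV .
  let ?I = "eval_at S x \<inter> eval_at S y"
  have I: "VF.subspace ?I" by (intro VF.subspace_inter eval_at_subspace operator_space_S)
  have "?I \<subset> eval_at S x" using wide_not_subset by blast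
  hence "VF.dim ?I < rk S x"
    using VF.dim_psubset[of ?I "eval_at S x"] I eval_at_subspace[OF operator_space_S, of x]
    by (simp add: VF.span_eq_iff[THEN iffD2])
  moreover have "?X \<subseteq> eval_at S x" "?Y \<subseteq> eval_at S y"
    by (rule subset_trans[OF Xc core_subset], rule subset_trans[OF Yc core_subset])
  moreover have "?X \<subseteq> eval_at S y" "?Y \<subseteq> eval_at S x"
    by (intro eval_at_mono; auto simp: vanishing_def)+
  ultimately have "VF.dim ?I < rk S x" "?X \<subseteq> ?I" "?Y \<subseteq> ?I" by simp_all
  moreover from this have "?P \<subseteq> ?I" 
    by (intro subsetI) (elim CollectE exE conjE, simp only:, rule VF.subspace_add[OF I], blast+)
  ultimately have "?P = ?I"
    using P I dimP wideD(3) by (intro VF.subspace_dim_equal) auto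
  hence "v \<in> ?P" using assms by blast
  thus ?thesis by (auto simp: eval_at_def)
qed

end

lemma linked_pair_of_wide:
  assumes "wide_pair S m x y" "linear_form \<phi>" "\<And>v. \<phi> v = 0 \<longleftrightarrow> v \<in> eval_at S x"
    "linear_form \<psi>" "\<And>v. \<psi> v = 0 \<longleftrightarrow> v \<in> eval_at S y"
  shows "linked_pair \<iota> sU sV BD BV S x y \<phi> \<psi>"
  using wideD[OF assms(1)] wide_inter[OF assms(1)] wide_not_subset[OF assms(1)]
    wide_not_subset[OF wide_pair_sym[OF assms(1)]] assms
  by (intro linked_pair.intro linked_pair_axioms.intro division_ring_spaces_axioms operator_space_S
      deep_scalars[OF ctx])

lemma polar_pair_of_wide:
  assumes "wide_pair S m x y" "linear_form \<phi>" "\<And>v. \<phi> v = 0 \<longleftrightarrow> v \<in> eval_at S x"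
    "linear_form \<psi>" "\<And>v. \<psi> v = 0 \<longleftrightarrow> v \<in> eval_at S y"
  obtains c b where "c \<noteq> 0" "polar_pair \<iota> sU sV BD BV S x y (\<lambda>v. c * \<phi> v) \<psi> b"
proof -
  interpret linked_pair \<iota> sU sV BD BV S x y \<phi> \<psi>
    by (rule linked_pair_of_wide[OF assms])
  obtain c where c: "c \<noteq> 0" "\<And>f. f \<in> S \<Longrightarrow> \<phi> (f y) = c * \<psi> (f x)"
    by (rule exists_normalisation) blast
  let ?\<phi> = "\<lambda>v. (- 1 / c) * \<phi> v"
  have form: "linear_form ?\<phi>" by (rule linear_form_scale[OF assms(2)])
  have "?\<phi> v = 0 \<longleftrightarrow> v \<in> eval_at S x" for v using c(1) assms(3)[of v] by simp
  from linked_pair_of_wide[OF assms(1) form this assms(4,5)]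
  interpret c: linked_pair \<iota> sU sV BD BV S x y ?\<phi> \<psi> .
  have "normalised_pair \<iota> sU sV BD BV S x y ?\<phi> \<psi>"
    by (intro normalised_pair.intro normalised_pair_axioms.intro c.linked_pair_axioms)
      (use c in \<open>simp add: field_simps\<close>)
  then interpret c: normalised_pair \<iota> sU sV BD BV S x y ?\<phi> \<psi> .
  obtain b where b: "\<And>z. linear_form (b z)"
    "\<And>v. Vector_Spaces.linear (restrict_scalars \<iota> sU) (*) (\<lambda>z. b z v)"
    "\<And>z f. f \<in> S \<Longrightarrow> b z (f x) = - ?\<phi> (f z)" "\<And>z f. f \<in> S \<Longrightarrow> b z (f y) = - \<psi> (f z)"
    using c.exists_polar_form by blast
  have "polar_pair \<iota> sU sV BD BV S x y ?\<phi> \<psi> b"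
    by (intro polar_pair.intro polar_pair_axioms.intro c.normalised_pair_axioms b)
  thus ?thesis using that[of "- 1 / c" b] c(1) by simp
qed

text \<open>Scaling \<open>x\<close> changes \<open>S x\<close> but neither its core nor the maps
  killing \<open>x\<close>. This supplies a second hyperplane for the comparison of polar
  forms.\<close>

lemma wide_pair_rscale:
  assumes "wide_pair S m x y" "a \<noteq> 0"
  shows "wide_pair S m (sU x a) y" "eval_at S (sU x a) = (\<lambda>v. v \<cdot> a) ` eval_at S x"
proof -
  have eval: "eval_at T (sU z a) = (\<lambda>v. v \<cdot> a) ` eval_at T z" if "operator_space T" for T z
    unfolding eval_at_image image_image by (intro image_cong refl operator_rscale[OF that])
  have rk: "rk T (sU z a) = rk T z" if "operator_space T" for T z
    by (simp only: eval[OF that] dim_image_rscale[OF assms(2)])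
  have zero: "v \<cdot> a = 0 \<longleftrightarrow> v = 0" for v
    using V_subspaceD(6)[OF V_subspace_0 assms(2), of v] by simp
  have "f \<in> S \<and> f (sU x a) = 0 \<longleftrightarrow> f \<in> S \<and> f x = 0" for f
    using operator_rscale[OF operator_space_S, of f x a] zero[of "f x"] by auto
  hence van: "vanishing S (sU x a) = vanishing S x"
    unfolding vanishing_def by simp
  have "core ((\<lambda>v. v \<cdot> a) ` A) = core A" for A
  proof -
    have "u \<cdot> c \<in> (\<lambda>v. v \<cdot> a) ` A \<longleftrightarrow> u \<cdot> (c * inverse a) \<in> A" for u c
    proof
      assume "u \<cdot> c \<in> (\<lambda>v. v \<cdot> a) ` A"
      then obtain v where "v \<in> A" "u \<cdot> c = v \<cdot> a" by blast
      thus "u \<cdot> (c * inverse a) \<in> A" using assms(2) by (simp flip: V.rscale_rscale)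
    next
      assume "u \<cdot> (c * inverse a) \<in> A"
      moreover have "u \<cdot> c = u \<cdot> (c * inverse a) \<cdot> a"
        using assms(2) by (simp flip: V.rscale_rscale)
      ultimately show "u \<cdot> c \<in> (\<lambda>v. v \<cdot> a) ` A" by blast
    qed
    moreover have "(\<forall>c. u \<cdot> (c * inverse a) \<in> A) \<longleftrightarrow> (\<forall>c. u \<cdot> c \<in> A)" for u
    proof safe
      fix c assume "\<forall>c. u \<cdot> (c * inverse a) \<in> A"
      from spec[OF this, of "c * a"] show "u \<cdot> c \<in> A" using assms(2) by (simp add: mult.assoc)
    qed auto
    ultimately show ?thesis unfolding core_def by auto
  qed
  hence core: "core (eval_at S (sU x a)) = core (eval_at S x)"
    by (simp add: eval[OF operator_space_S])
  show "wide_pair S m (sU x a) y"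
    using assms(1) unfolding wide_pair_def max_rank_def
    by (simp add: rk[OF operator_space_S] rk[OF operator_space_vanishing[OF operator_space_S]] van core)
  show "eval_at S (sU x a) = (\<lambda>v. v \<cdot> a) ` eval_at S x" by (rule eval[OF operator_space_S])
qed

lemma polar_pair_rscale:
  assumes "wide_pair S m x y" "a \<noteq> 0" "linear_form \<phi>" "\<And>v. \<phi> v = 0 \<longleftrightarrow> v \<in> eval_at S x"
    "linear_form \<psi>" "\<And>v. \<psi> v = 0 \<longleftrightarrow> v \<in> eval_at S y"
  obtains c b where "c \<noteq> 0"
    "polar_pair \<iota> sU sV BD BV S (sU x a) y (\<lambda>v. c * \<phi> (v \<cdot> inverse a)) \<psi> b"
proof -
  have "linear_form (\<lambda>v. \<phi> (v \<cdot> inverse a))"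
  proof (rule VF.linear_formI)
    show "\<phi> ((u + v) \<cdot> inverse a) = \<phi> (u \<cdot> inverse a) + \<phi> (v \<cdot> inverse a)" for u v
      by (simp add: V.add_rscale form_simps[OF assms(3)])
    show "\<phi> (restrict_scalars \<iota> sV c v \<cdot> inverse a) = c * \<phi> (v \<cdot> inverse a)" for c v
      using form_rscale[OF assms(3), of "v \<cdot> inverse a" c]
      by (simp add: VF_scale_eq V.rscale_rscale \<iota>_central)
  qed
  moreover have "\<phi> (v \<cdot> inverse a) = 0 \<longleftrightarrow> v \<in> eval_at S (sU x a)" for v
    using assms(2) unfolding assms(4) wide_pair_rscale(2)[OF assms(1,2)] by (force simp: image_iff)
  ultimately show ?thesis
    using polar_pair_of_wide[OF wide_pair_rscale(1)[OF assms(1,2)] _ _ assms(5,6)] that by blast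
qed

text \<open>Each side vanishes on its own core, which is stable under scalars. Since the cores span,
  both sides vanish everywhere, and \<open>twisted_form_independent\<close> applies.\<close>

lemma wide_forms_independent:
  assumes "wide_pair S m x y" "a \<notin> range \<iota>" "linear_form \<phi>" "\<And>v. \<phi> v = 0 \<longleftrightarrow> v \<in> eval_at S x"
    "linear_form \<psi>" "\<And>v. \<psi> v = 0 \<longleftrightarrow> v \<in> eval_at S y"
    and eq: "\<And>v. \<alpha>' * \<phi> v + \<beta> * \<phi> (v \<cdot> inverse a) = \<gamma> * \<psi> v + \<delta> * \<psi> (v \<cdot> inverse a)"
  shows "\<alpha>' = 0 \<and> \<beta> = 0"
proof -
  obtain u where "u \<notin> eval_at S x" using eval_at_neq_UNIV by blast
  moreover have "\<alpha>' * \<phi> v + \<beta> * \<phi> (v \<cdot> inverse a) = 0" for v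
  proof -
    obtain p q where pq: "v = p + q" "p \<in> core (eval_at S x)" "q \<in> core (eval_at S y)"
      using wide_cores_sum[OF assms(1)] by blast
    have "\<phi> p = 0" "\<phi> (p \<cdot> inverse a) = 0" "\<psi> q = 0" "\<psi> (q \<cdot> inverse a) = 0"
      using pq core_subset unfolding assms(4,6) by (auto simp: core_def subset_iff)
    thus ?thesis
      using eq[of q] by (simp add: pq(1) V.add_rscale form_simps[OF assms(3)])
  qed
  ultimately show ?thesis
    using twisted_form_independent[OF assms(2,3), of u] assms(4) by blast
qed

lemma exists_alternator:
  assumes "wide_pair S m x y"
  obtains b \<phi> \<psi> where "alternator S b" "polar_pair \<iota> sU sV BD BV S x y \<phi> \<psi> b"
proof -
  obtain \<phi>0 where \<phi>0: "linear_form \<phi>0" "\<And>v. \<phi>0 v = 0 \<longleftrightarrow> v \<in> eval_at S x"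
    using hyperplane_form[OF eval_at_subspace[OF operator_space_S, of x]] wideD(3)[OF assms] dimV by metis
  obtain \<psi> where \<psi>: "linear_form \<psi>" "\<And>v. \<psi> v = 0 \<longleftrightarrow> v \<in> eval_at S y"
    using hyperplane_form[OF eval_at_subspace[OF operator_space_S, of y]] wideD(4)[OF assms] dimV by metis
  obtain c b where c: "c \<noteq> 0" and b: "polar_pair \<iota> sU sV BD BV S x y (\<lambda>v. c * \<phi>0 v) \<psi> b"
    using polar_pair_of_wide[OF assms \<phi>0 \<psi>] by blast
  define \<phi> where "\<phi> = (\<lambda>v. c * \<phi>0 v)"
  note b = b[folded \<phi>_def]
  interpret P: polar_pair \<iota> sU sV BD BV S x y \<phi> \<psi> b by (rule b)
  have zero: "b z (h z) = 0" if h: "h \<in> S" for z h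
  proof (cases "d = 1")
    case True
    note op_x = operator_space_vanishing[OF operator_space_S, of x]
    have "many_scalars (Suc (rk (vanishing S x) y))"
      using scalars wideD(8)[OF assms] by auto
    \<comment> \<open>Moving \<open>z\<close> along \<open>y\<close> leaves the defect unchanged and
      brings the rank of \<open>vanishing S x\<close> up to \<open>m * d - 1\<close>, which is
      \<open>VF.dim UNIV - 2\<close> when \<open>d = 1\<close>.\<close>
    then obtain s where s: "rk (vanishing S x) y \<le> rk (vanishing S x) (sU y (\<iota> s) + z)"
      using exists_rank_ge_on_line[OF op_x] by blast
    let ?z = "sU y (\<iota> s) + z"
    have "b ?z (h ?z) = 0"
      using s wideD(8)[OF assms] dimV True eval_at_neq_UNIV[of ?z]
      by (intro P.b_eq_0_of_large_rank h) auto
    moreover have "sU x 0 = 0" using U.rscale_add[of x 0 0] by simp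
    ultimately show ?thesis
      using P.b_translate[OF h, of z 0 s] by (simp add: add.commute)
  next
    case False
    have "\<exists>a. a \<notin> range \<iota>"
    proof (rule ccontr)
      assume "\<not> ?thesis"
      hence "UNIV \<subseteq> D.span {1}"
        by (auto simp: D.span_singleton restrict_scalars_def)
      from D.dim_le_card[OF this] False d_pos show False by simp
    qed
    then obtain a where a: "a \<notin> range \<iota>" by blast
    have "a \<noteq> 0" using a \<iota>_simps(2) by (metis rangeI)
    obtain c1 b1 where c1: "c1 \<noteq> 0"
      and b1: "polar_pair \<iota> sU sV BD BV S (sU x a) y (\<lambda>v. c1 * \<phi> (v \<cdot> inverse a)) \<psi> b1"
      using polar_pair_rscale[OF assms \<open>a \<noteq> 0\<close> P.form_\<phi> P.ker_\<phi> \<psi>] by blast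
    obtain c2 b2 where c2: "c2 \<noteq> 0"
      and b2: "polar_pair \<iota> sU sV BD BV S (sU y a) x (\<lambda>v. c2 * \<psi> (v \<cdot> inverse a)) \<phi> b2"
      using polar_pair_rscale[OF wide_pair_sym[OF assms] \<open>a \<noteq> 0\<close> \<psi> P.form_\<phi> P.ker_\<phi>] by blast
    note indep = wide_forms_independent[OF assms a P.form_\<phi> P.ker_\<phi> \<psi>]
    note indep' = wide_forms_independent[OF wide_pair_sym[OF assms] a \<psi> P.form_\<phi> P.ker_\<phi>]
    show ?thesis
    proof (rule ccontr)
      assume nz: "b z (h z) \<noteq> 0"
      have "\<not> (\<forall>v. \<phi> v = e * (c1 * \<phi> (v \<cdot> inverse a)) + e' * \<psi> v)" for e e'
        using indep[of 1 "- (e * c1)" e' 0] by (auto simp: algebra_simps)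
      from polar_forms_compare[OF b b1 this h nz]
      obtain e1 e2 e3 where e: "\<And>v. b z v = e1 * \<phi> v + e2 * \<psi> v + e3 * (c1 * \<phi> (v \<cdot> inverse a))"
        by blast
      have "\<not> (\<forall>v. \<psi> v = e * (c2 * \<psi> (v \<cdot> inverse a)) + e' * \<phi> v)" for e e'
        using indep'[of 1 "- (e * c2)" e' 0] by (auto simp: algebra_simps)
      from polar_forms_compare[OF P.polar_pair_sym b2 this h nz]
      obtain e1' e2' e3' where e': "\<And>v. b z v = e1' * \<psi> v + e2' * \<phi> v + e3' * (c2 * \<psi> (v \<cdot> inverse a))"
        by blast
      \<comment> \<open>Scaling \<open>x\<close> and scaling \<open>y\<close> give two expressions
        for \<open>b z\<close>. Equating them eliminates the twisted forms, so \<open>b z\<close>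
        lies in the span of \<phi> and \<psi>.\<close>
      have "(e1 - e2') * \<phi> v + (e3 * c1) * \<phi> (v \<cdot> inverse a) =
        (e1' - e2) * \<psi> v + (e3' * c2) * \<psi> (v \<cdot> inverse a)" for v
        using e[of v] e'[of v] by (simp add: algebra_simps)
      from indep[OF this] have "e3 = 0" using c1 by simp
      hence "b z v = e1 * \<phi> v + e2 * \<psi> v" for v using e by simp
      from P.b_eq_0_of_span[OF this h] nz show False by simp
    qed
  qed
  have "alternator S b"
    by (rule alternatorI) (simp_all add: P.form_b P.linear_b zero)
  thus ?thesis using that b by blast
qed

end

end

section \<open>Nondegeneracy\<close>

context division_ring_spaces
begin

text \<open>With uniqueness, the scaled form is a multiple of \<open>b\<close>; this makes the
  radical of \<open>b\<close> closed under scalars of the division ring.\<close>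

lemma alternator_rscale:
  assumes "alternator S b" "operator_space S"
  shows "alternator S (\<lambda>z v. b (sU z a) (v \<cdot> a))"
proof (rule alternatorI)
  note form = alternatorD(1)[OF assms(1)] and lin = alternatorD(2)[OF assms(1)]
  show "linear_form (\<lambda>v. b (sU z a) (v \<cdot> a))" for z
  proof (rule VF.linear_formI)
    show "b (sU z a) ((u + v) \<cdot> a) = b (sU z a) (u \<cdot> a) + b (sU z a) (v \<cdot> a)" for u v
      by (simp add: V.add_rscale form_simps[OF form])
    show "b (sU z a) (restrict_scalars \<iota> sV c v \<cdot> a) = c * b (sU z a) (v \<cdot> a)" for c v
      using form_rscale[OF form, of "sU z a" "v \<cdot> a" c]
      by (simp add: VF_scale_eq V.rscale_rscale \<iota>_central)
  qed
  show "Vector_Spaces.linear (restrict_scalars \<iota> sU) (*) (\<lambda>z. b (sU z a) (v \<cdot> a))" for v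
  proof (rule UF.linear_formI)
    show "b (sU (z + w) a) (v \<cdot> a) = b (sU z a) (v \<cdot> a) + b (sU w a) (v \<cdot> a)" for z w
      by (simp add: U.add_rscale UF.form_add[OF lin])
    show "b (sU (restrict_scalars \<iota> sU c z) a) (v \<cdot> a) = c * b (sU z a) (v \<cdot> a)" for c z
      using UF.form_scale[OF lin, of c "sU z a" "v \<cdot> a"]
      by (simp add: restrict_scalars_def U.rscale_rscale \<iota>_central)
  qed
  show "b (sU z a) (f z \<cdot> a) = 0" if "f \<in> S" for z f
    using alternatorD(3)[OF assms(1) that, of "sU z a"] by (simp add: operator_rscale[OF assms(2) that])
qed

text \<open>Modulo its radical, \<open>b\<close> is a right-nondegenerate alternator, and this
  forces deep intransitivity: if the maps into \<open>W\<close> reached all of \<open>W\<close> at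
  \<open>x\<close>, then \<open>b x\<close> would vanish on \<open>W\<close>, and by polarisation
  \<open>W\<close> would lie in the radical.\<close>

lemma deep_projection:
  assumes b: "alternator S b" and op: "operator_space S"
    and K: "\<And>v. \<pi> v = 0 \<longleftrightarrow> (\<forall>z. b z v = 0)"
    and \<pi>: "\<And>x y. \<pi> (x + y) = \<pi> x + \<pi> y" "\<And>x a. \<pi> (x \<cdot> a) = \<pi> x \<cdot> a" "\<And>x. \<pi> (\<pi> x) = \<pi> x"
  shows "deep ((\<lambda>f. \<pi> \<circ> f) ` S) (range \<pi>)"
proof -
  let ?T = "(\<lambda>f. \<pi> \<circ> f) ` S"
  have \<pi>_diff: "\<pi> (x - y) = \<pi> x - \<pi> y" for x y
    using \<pi>(1)[of "x - y" y] by simp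
  have \<pi>0: "\<pi> 0 = 0" using \<pi>_diff[of 0 0] by simp
  have b\<pi>: "b z (\<pi> v) = b z v" for z v
  proof -
    have "\<pi> (\<pi> v - v) = 0" by (simp add: \<pi>_diff \<pi>(3))
    hence "b z (\<pi> v - v) = 0" using K by blast
    thus ?thesis by (simp add: form_simps[OF alternatorD(1)[OF b]])
  qed
  have opT: "operator_space ?T"
    unfolding operator_space_def
  proof
    show "?T \<subseteq> Hom sU sV"
      using op by (auto simp: operator_space_def Hom_def \<pi>)
    show "H.subspace ?T"
    proof (rule H.subspaceI)
      have "0 = \<pi> \<circ> 0" by (auto simp: \<pi>0)
      thus "0 \<in> ?T" using space_0[OF op] by blast
      show "f + g \<in> ?T" if fg: "f \<in> ?T" "g \<in> ?T" for f g
      proof -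
        obtain f' g' where "f' \<in> S" "g' \<in> S" "f = \<pi> \<circ> f'" "g = \<pi> \<circ> g'"
          using fg by blast
        moreover from this have "f + g = \<pi> \<circ> (f' + g')" by (auto simp: \<pi>)
        ultimately show ?thesis using space_add[OF op] by blast
      qed
      show "scH c f \<in> ?T" if f: "f \<in> ?T" for c f
      proof -
        obtain f' where "f' \<in> S" "f = \<pi> \<circ> f'" using f by blast
        moreover from this have "scH c f = \<pi> \<circ> scH c f'" by (auto simp: \<pi> scH_apply fun_eq_iff)
        ultimately show ?thesis using space_scale[OF op] by blast
      qed
    qed
  qed
  have altT: "alternator ?T b"
    using alternatorD[OF b] by (intro alternatorI) (auto simp: b\<pi>)
  have L: "V.subspace (range \<pi>)"
    unfolding V.subspace_def by (auto simp flip: \<pi>(1,2) intro: range_eqI[of _ _ 0] simp: \<pi>0)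
  have "intransitive (maps_into ?T W) W" if W: "V.subspace W" "W \<noteq> {0}" "W \<subseteq> range \<pi>" for W
    unfolding intransitive_def
  proof (intro allI notI)
    fix x assume eq: "eval_at (maps_into ?T W) x = W"
    have g: "\<exists>g. g \<in> ?T \<and> range g \<subseteq> W \<and> w = g x" if "w \<in> W" for w
    proof -
      have "w \<in> eval_at (maps_into ?T W) x" using that eq by simp
      thus ?thesis unfolding eval_at_def maps_into_def by blast
    qed
    have bx: "b x w = 0" if "w \<in> W" for w
      using g[OF that] alternatorD(3)[OF altT] by blast
    have "w = 0" if w: "w \<in> W" for w
    proof -
      obtain g where g: "g \<in> ?T" "range g \<subseteq> W" "w = g x" using g[OF w] by blast
      have "b z w = 0" for z
        using alternator_polar[OF altT opT g(1), of z x] g(2) bx by (simp add: g(3) subset_iff)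
      hence "\<pi> w = 0" using K by blast
      moreover have "\<pi> w = w" using w W(3) \<pi>(3) by auto
      ultimately show ?thesis by simp
    qed
    thus False using W(2) V_subspaceD(1)[OF W(1)] by blast
  qed
  thus ?thesis
    unfolding deep_def using opT L by auto
qed

text \<open>A radical of dimension \<open>k\<close> with complement of dimension \<open>j\<close>,
  both positive, bounds \<open>dim S\<close> by
  \<open>\<alpha> k d + \<alpha> j d = \<alpha> n d - d * k * j\<close>. The hypothesis then
  requires \<open>d * k * j + 2 \<le> k + j\<close>, which is impossible.\<close>

lemma alternator_nondegenerate:
  assumes S: "deep S UNIV" and dimV: "VF.dim UNIV = n * d" and scalars: "many_scalars (n * d)"
    and dim: "int (H.dim S) \<ge> \<alpha> n d - int n + max (4 - int d) 2"
    and b: "alternator S b" "b z0 v0 \<noteq> 0"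
    and uniq: "\<And>b'. alternator S b' \<Longrightarrow> \<exists>c. \<forall>z v. b' z v = c * b z v"
  shows "right_nondegenerate b"
proof -
  have op: "operator_space S" using deepD(1)[OF S] .
  define K where "K = {v. \<forall>z. b z v = 0}"
  note form = form_simps[OF alternatorD(1)[OF b(1)]]
  have "v \<cdot> a \<in> K" if v: "v \<in> K" for v a
  proof (cases "a = 0")
    case False
    obtain c where c: "\<forall>z v. b (sU z a) (v \<cdot> a) = c * b z v"
      using uniq[OF alternator_rscale[OF b(1) op]] by blast
    have "b z (v \<cdot> a) = 0" for z
      using spec[OF c, of "sU z (inverse a)"] v False by (simp add: K_def)
    thus ?thesis by (simp add: K_def)
  qed (simp add: K_def form)
  hence K: "V.subspace K"
    unfolding V.subspace_def by (auto simp: K_def form)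
  have "K = {0}"
  proof (rule ccontr)
    assume neq: "K \<noteq> {0}"
    obtain \<pi> where \<pi>: "\<And>x y. \<pi> (x + y) = \<pi> x + \<pi> y" "\<And>x a. \<pi> (x \<cdot> a) = \<pi> x \<cdot> a"
      "\<And>x. \<pi> x = 0 \<longleftrightarrow> x \<in> K" "\<And>x. \<pi> (\<pi> x) = \<pi> x"
      by (rule exists_projection[OF K]) blast
    interpret VV: vector_space_pair "restrict_scalars \<iota> sV" "restrict_scalars \<iota> sV" ..
    interpret HH: vector_space_pair scH scH ..
    have lin_\<pi>: "Vector_Spaces.linear (restrict_scalars \<iota> sV) (restrict_scalars \<iota> sV) \<pi>"
      unfolding Vector_Spaces.linear_iff using VF.vector_space_axioms by (simp add: VF_scale_eq \<pi>)
    have lin_comp: "Vector_Spaces.linear scH scH (\<lambda>f. \<pi> \<circ> f)"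
      unfolding Vector_Spaces.linear_iff using H.vector_space_axioms
      by (auto simp: fun_eq_iff \<pi> scH_apply)
    let ?T = "(\<lambda>f. \<pi> \<circ> f) ` S"
    have T: "deep ?T (range \<pi>)"
      by (rule deep_projection[OF b(1) op _ \<pi>(1,2,4)]) (simp add: \<pi>(3) K_def)
    obtain k where k: "VF.dim K = k * d" using dim_dvd[OF K] by (metis dvdE mult.commute)
    obtain j where j: "VF.dim (range \<pi>) = j * d"
      using dim_dvd[OF deepD(2)[OF T]] by (metis dvdE mult.commute)
    have "VF.dim UNIV = VF.dim (range \<pi>) + VF.dim {v \<in> UNIV. \<pi> v = 0}"
      by (rule VV.rank_nullity_on(2)[OF lin_\<pi> VF.subspace_UNIV VF.finite_Basis _ VF.finite_Basis])
        (simp_all add: VF.span_Basis)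
    hence "n * d = (k + j) * d"
      by (simp add: \<pi>(3) k j dimV add_mult_distrib)
    hence n: "n = k + j" using d_pos unfolding mult_cancel2 by linarith
    have scal: "many_scalars (k * d)" "many_scalars (j * d)"
      using scalars unfolding n by (auto simp: add_mult_distrib)
    have "k \<noteq> 0" using k neq V_subspaceD(1)[OF K] by auto
    have "j \<noteq> 0"
    proof
      assume "j = 0"
      hence "\<pi> v0 = 0" using j by auto
      thus False using b(2) \<pi>(3) by (simp add: K_def)
    qed
    have ker: "{f \<in> S. \<pi> \<circ> f = 0} = maps_into S K"
      by (auto simp: maps_into_def fun_eq_iff \<pi>(3))
    have SK: "deep (maps_into S K) K"
      by (rule deep_subset[OF S operator_space_maps_into[OF op K] _ K]) (auto simp: maps_into_def)
    note dimK = dim_deep_le[OF SK k scal(1)] and dimT = dim_deep_le[OF T j scal(2)]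
    obtain B C where "finite B" "maps_into S K \<subseteq> H.span B" "finite C" "?T \<subseteq> H.span C"
      using dimK dimT by blast
    hence "H.dim S = H.dim ?T + H.dim (maps_into S K)"
      using HH.rank_nullity_on(2)[OF lin_comp, of S B C] op ker by (simp add: operator_space_def)
    hence "int (H.dim S) \<le> \<alpha> k d + \<alpha> j d"
      using dimK dimT by simp
    hence "int (d * k * j) + max (4 - int d) 2 \<le> int (k + j)"
      using dim unfolding n \<alpha>_add by simp
    moreover have "k + j \<le> d * k * j + 1"
    proof -
      obtain k' j' where kj: "k = Suc k'" "j = Suc j'"
        using \<open>k \<noteq> 0\<close> \<open>j \<noteq> 0\<close> not0_implies_Suc by metis
      have "k + j \<le> k * j + 1" by (simp add: kj)
      also have "k * j \<le> d * (k * j)" using d_pos by simp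
      finally show ?thesis by (simp add: mult.assoc)
    qed
    moreover have "max (4 - int d) 2 \<ge> 2" by simp
    ultimately show False by linarith
  qed
  thus ?thesis by (simp add: right_nondegenerate_def K_def)
qed

end

section \<open>Restriction of scalars and assembly of the theorem\<close>

lemma finite_basis_restrict_scalars:
  fixes \<iota> :: "'f::field \<Rightarrow> 'd::division_ring"
  assumes \<iota>: "central_subfield \<iota>" and D: "finite_dimensional_vector_space (restrict_scalars \<iota> (*)) BD"
    and V: "right_vector_space sV" "right_vector_space.finite_dimensional sV"
  obtains BV where "finite_dimensional_vector_space (restrict_scalars \<iota> sV) BV"
proof -
  interpret V: right_vector_space sV by fact
  interpret D: finite_dimensional_vector_space "restrict_scalars \<iota> ((*) :: 'd \<Rightarrow> 'd \<Rightarrow> 'd)" BD by fact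
  interpret VF: vector_space "restrict_scalars \<iota> sV" by (rule vector_space_restrict_scalars[OF \<iota> V(1)])
  have central: "\<iota> c * a = a * \<iota> c" for c a using \<iota> by (simp add: central_subfield_def)
  obtain B where B: "finite B" "V.span B = UNIV" using V(2) by (auto simp: V.finite_dimensional_def)
  \<comment> \<open>Products of generators over the division ring with a basis of the division ring
    generate over the central subfield.\<close>
  define G where "G = (\<lambda>(b, a). sV b a) ` (B \<times> BD)"
  have gen: "sV b e \<in> VF.span G" if b: "b \<in> B" for b e
  proof -
    have zero: "sV b 0 = 0" using V.rscale_add[of b 0 0] by simp
    have "D.span BD \<subseteq> {e. sV b e \<in> VF.span G}"
    proof (rule D.span_minimal)
      show "BD \<subseteq> {e. sV b e \<in> VF.span G}"
        using b by (auto simp: G_def intro!: VF.span_base)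
      show "D.subspace {e. sV b e \<in> VF.span G}"
      proof (rule D.subspaceI)
        show "restrict_scalars \<iota> (*) c e \<in> {e. sV b e \<in> VF.span G}"
          if "e \<in> {e. sV b e \<in> VF.span G}" for c e
          using VF.span_scale[of "sV b e" G c] that by (simp add: restrict_scalars_def V.rscale_rscale)
      qed (auto simp: zero V.rscale_add VF.span_zero VF.span_add)
    qed
    thus ?thesis using D.span_Basis by blast
  qed
  have scale: "sV v a \<in> VF.span G" if v: "v \<in> VF.span G" for v a
  proof -
    have zero: "sV 0 a = 0" using V.add_rscale[of 0 0 a] by simp
    have "VF.span G \<subseteq> {v. sV v a \<in> VF.span G}"
    proof (rule VF.span_minimal)
      show "G \<subseteq> {v. sV v a \<in> VF.span G}"
        using gen by (auto simp: G_def V.rscale_rscale)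
      show "VF.subspace {v. sV v a \<in> VF.span G}"
      proof (rule VF.subspaceI)
        show "restrict_scalars \<iota> sV c v \<in> {v. sV v a \<in> VF.span G}"
          if "v \<in> {v. sV v a \<in> VF.span G}" for c v
          using VF.span_scale[of "sV v a" G c] that
          by (simp add: restrict_scalars_def V.rscale_rscale central)
      qed (auto simp: zero V.add_rscale VF.span_zero VF.span_add)
    qed
    thus ?thesis using v by blast
  qed
  have "V.span B \<subseteq> VF.span G"
    unfolding V.span_def
  proof (rule hull_minimal)
    show "B \<subseteq> VF.span G" using gen[of _ 1] by (auto simp: V.rscale_one)
    show "V.subspace (VF.span G)"
      unfolding V.subspace_def using scale by (simp add: VF.span_zero VF.span_add)
  qed
  hence G: "VF.span G = UNIV" using B(2) by blast
  have finG: "finite G" using B(1) D.finite_Basis by (simp add: G_def)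
  obtain BV where BV: "BV \<subseteq> G" "VF.independent BV" "G \<subseteq> VF.span BV"
    using VF.maximal_independent_subset by blast
  have "VF.span BV = UNIV"
    using G BV(3) VF.span_minimal[OF BV(3) VF.subspace_span] by blast
  with BV finG have "finite_dimensional_vector_space (restrict_scalars \<iota> sV) BV"
    by unfold_locales (auto intro: finite_subset)
  thus ?thesis by (rule that)
qed

theorem theorem1p22:
  fixes \<iota> :: "'f::field \<Rightarrow> 'd::division_ring"
    and sU :: "'u::ab_group_add \<Rightarrow> 'd \<Rightarrow> 'u"
    and sV :: "'v::ab_group_add \<Rightarrow> 'd \<Rightarrow> 'v"
    and S :: "('u \<Rightarrow> 'v) set"
    and n d dimS :: nat
    and AltS :: "('u \<Rightarrow> 'v \<Rightarrow> 'f) set"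
  assumes "central_subfield \<iota>"
    and "\<exists>B. finite_dimensional_vector_space (restrict_scalars \<iota> (*)) B"
    and "d = vector_space.dim (restrict_scalars \<iota> (*)) UNIV"
    and "right_vector_space sU" and "right_vector_space.finite_dimensional sU"
    and "right_vector_space sV" and "right_vector_space.finite_dimensional sV"
    and "n = right_vector_space.dimension sV"
    and "S \<subseteq> Hom sU sV"
    and "module.subspace (pointwise_scale (restrict_scalars \<iota> sV)) S"
    and "deeply_intransitive sV S"
    and "infinite (UNIV :: 'f set) \<or> n * d \<le> card (UNIV :: 'f set)"
    and "dimS = vector_space.dim (pointwise_scale (restrict_scalars \<iota> sV)) S"
    and "AltS = Alt (restrict_scalars \<iota> sU) (restrict_scalars \<iota> sV) S"
  shows "int dimS \<le> \<alpha> n d \<and>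
    (int (trk (restrict_scalars \<iota> sV) S) < int (n * d) - 1 \<longrightarrow>
       int dimS \<le> \<alpha> n d - int n + max (2 - int d) 0) \<and>
    (int dimS \<ge> \<alpha> n d - int n + max (4 - int d) 2 \<longrightarrow>
       (\<exists>b\<in>AltS. right_nondegenerate b \<and> AltS = {(\<lambda>x y. c * b x y) | c. True}))"
proof -
  obtain BD where BD: "finite_dimensional_vector_space (restrict_scalars \<iota> ((*) :: 'd \<Rightarrow> 'd \<Rightarrow> 'd)) BD"
    using assms(2) by blast
  obtain BV where BV: "finite_dimensional_vector_space (restrict_scalars \<iota> sV) BV"
    by (rule finite_basis_restrict_scalars[OF assms(1) BD assms(6,7)])
  interpret division_ring_spaces \<iota> sU sV BD BV
    by (intro division_ring_spaces.intro division_ring_spaces_axioms.intro assms BD BV)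
  have deep: "deep S UNIV"
    using assms(9-11) by (simp add: deep_def operator_space_def deeply_intransitive_def V_subspace_UNIV)
  have dimV: "VF.dim UNIV = n * d"
    using V_dimension assms(3,8) by simp
  have scalars: "many_scalars (n * d)"
    unfolding many_scalars_iff by (rule assms(12))
  note dimV' = dimV[unfolded assms(3)] and scalars' = scalars[unfolded assms(3)]
  have a: "int dimS \<le> \<alpha> n d"
    using dim_deep_le[OF deep dimV' scalars'] assms(3,13) by simp
  have b: "int dimS \<le> \<alpha> n d - int n + max (2 - int d) 0"
    if "int (trk (restrict_scalars \<iota> sV) S) < int (n * d) - 1"
  proof -
    \<comment> \<open>The ranks are bounded by the dimension, so the \<open>Max\<close> in
      \<open>trk\<close> is taken over a finite set.\<close>
    have "range (\<lambda>x. rk S x) \<subseteq> {..VF.dim UNIV}"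
      by (auto intro: VF.dim_subset)
    hence "finite (range (\<lambda>x. rk S x))" by (rule finite_subset) simp
    hence "rk S x \<le> trk (restrict_scalars \<iota> sV) S" for x
      unfolding trk_def by (rule Max_ge) simp
    hence "rk S x + 1 < n * d" for x
      using that by (smt (verit) of_nat_1 of_nat_add of_nat_less_iff of_nat_mono)
    from dim_deep_le_low_rank[OF deep dimV' scalars'] this show ?thesis
      using assms(3,13) by simp
  qed
  have c: "\<exists>b\<in>AltS. right_nondegenerate b \<and> AltS = {(\<lambda>x y. c * b x y) | c. True}"
    if dim: "int dimS \<ge> \<alpha> n d - int n + max (4 - int d) 2"
  proof -
    \<comment> \<open>For \<open>n = 0\<close> part (a) gives dimension 0, while the hypothesis of
      (c) asks for at least 2.\<close>
    have "n \<noteq> 0" using a dim by auto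
    then obtain m where m: "n = Suc m" using not0_implies_Suc by blast
    note dim' = dim[unfolded assms(3,13)]
    obtain x y where xy: "wide_pair S m x y"
      using exists_wide_pair[OF deep dimV'[unfolded m] scalars'[unfolded m] dim'[unfolded m]] by blast
    obtain b \<phi> \<psi> where b: "alternator S b" "polar_pair \<iota> sU sV BD BV S x y \<phi> \<psi> b"
      by (rule exists_alternator[OF deep dimV'[unfolded m] scalars'[unfolded m] xy])
    interpret polar_pair \<iota> sU sV BD BV S x y \<phi> \<psi> b by (rule b(2))
    have uniq: "\<exists>c. \<forall>z v. b' z v = c * b z v" if "alternator S b'" for b'
      by (rule alternator_unique[OF that])
    obtain f where "f \<in> S" "\<psi> (f x) = 1" by (rule obtain_dual)
    hence "b y (f x) \<noteq> 0" by (simp add: b_at_y)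
    hence "right_nondegenerate b"
      by (intro alternator_nondegenerate[OF deep dimV' scalars' dim' b(1)] uniq)
    moreover have scale: "alternator S (\<lambda>z v. c * b z v)" for c
    proof (rule alternatorI)
      show "linear_form (\<lambda>v. c * b z v)" for z by (rule linear_form_scale[OF form_b])
      show "Vector_Spaces.linear (restrict_scalars \<iota> sU) (*) (\<lambda>z. c * b z v)" for v
        by (rule UF.linear_formI)
          (simp_all add: UF.form_add[OF linear_b] UF.form_scale[OF linear_b] algebra_simps)
    qed (simp add: alternatorD(3)[OF b(1)])
    moreover have "AltS = {(\<lambda>x y. c * b x y) | c. True}"
    proof (intro equalityI subsetI)
      fix b' assume "b' \<in> AltS"
      then obtain c where "\<forall>z v. b' z v = c * b z v"
        using uniq unfolding alternator_def assms(14) by blast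
      hence "b' = (\<lambda>z v. c * b z v)" by (simp add: fun_eq_iff)
      thus "b' \<in> {(\<lambda>x y. c * b x y) | c. True}" by blast
    qed (use scale in \<open>auto simp: alternator_def assms(14)\<close>)
    ultimately show ?thesis
      using b(1) unfolding alternator_def assms(14) by blast
  qed
  from a b c show ?thesis by blast
qed

end
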